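(* Let $Y\sim\mathrm{TE}(0,K^{-1})$ be a continuous transelliptical random vector in $\mathbb{R}^d$, $d\ge2$, and let $i\ne j$ in $\{1,\dots,d\}$. The following are equivalent: (1) $K_{ij}=0$; (2) $\tau(g(Y_i),h(Y_j)\mid Y_{(ij)})=0$ for all strictly increasing $g,h:\mathbb{R}\to\mathbb{R}$; (3) $\tau(Y_i,Y_j\mid Y_{(ij)})=0$.
   Context: A random vector $X=(X_1,\dots,X_d)$ has an elliptical distribution, written $X\sim E(\mu,\Sigma)$, if its characteristic function has the form $\boldsymbol t\mapsto \phi(\boldsymbol t^T\Sigma \boldsymbol t)\exp(i\mu^T \boldsymbol t)$ for some $\phi:[0,\infty)\to\mathbb{R}$, where $\mu\in\mathbb{R}^d$ and $\Sigma$ is a $d\times d$ symmetric matrix; $\phi$ is left implicit. Standing assumptions: $\Sigma$ is positive definite and, in the stochastic representation $X=\mu+\xi\,\Sigma^{1/2}U$ with $U$ uniform on the unit sphere of $\mathbb{R}^d$, $\xi\ge 0$ and $\xi$ independent of $U$, one has $0<\mathbb{E}\xi^2<\infty$. A random vector $Y$ has a transelliptical distribution, written $Y\sim \mathrm{TE}(\mu,\Sigma)$, if $(f_1(Y_1),\dots,f_d(Y_d))\sim E(\mu,\Sigma)$ for some fixed (deterministic) strictly increasing functions $f_1,\dots,f_d:\mathbb{R}\to\mathbb{R}$. Put $K=\Sigma^{-1}$. $Y_{(ij)}$ denotes $Y$ with the coordinates $Y_i,Y_j$ removed (if $d=2$, there is no conditioning). Kendall's tau is considered for continuous random vectors (so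 ties have probability zero). The conditional Kendall correlation of $(A,B)$, where $A$ is a function of $Y_i$ and $B$ a function of $Y_j$, is $\tau(A,B\mid Y_{(ij)})=\operatorname{corr}(\operatorname{sign}(A-A'),\operatorname{sign}(B-B')\mid Y_{(ij)})$, where $(A',B')$ is an independent copy of $(A,B)$ from the conditional distribution given $Y_{(ij)}$. Equalities of conditional quantities are understood almost surely. *)

theory Defs
  imports "HOL-Probability.Probability"
begin

section \<open>Elliptical and transelliptical random vectors\<close>

definition elliptical ::
    "'w measure \<Rightarrow> ('w \<Rightarrow> real ^ 'd) \<Rightarrow> real ^ 'd \<Rightarrow> real ^ 'd ^ 'd \<Rightarrow> bool" where
  "elliptical M X \<mu> \<Sigma> \<longleftrightarrow>
     X \<in> borel_measurable M \<and> transpose \<Sigma> = \<Sigma> \<and>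
     (\<exists>\<phi> :: real \<Rightarrow> real. \<forall>t.
        (CLINT \<omega>|M. iexp (t \<bullet> X \<omega>)) = complex_of_real (\<phi> (t \<bullet> (\<Sigma> *v t))) * iexp (\<mu> \<bullet> t))"

definition positive_definite :: "real ^ 'd ^ 'd \<Rightarrow> bool" where
  "positive_definite A \<longleftrightarrow> transpose A = A \<and> (\<forall>x. x \<noteq> 0 \<longrightarrow> 0 < x \<bullet> (A *v x))"

text \<open>The uniform distribution on the unit sphere, obtained by radially projecting the uniform
  distribution on the unit ball (the normalised cone measure, which for the Euclidean norm is the
  normalised surface measure).\<close>

definition uniform_sphere :: "'a::euclidean_space measure" where
  "uniform_sphere = distr (uniform_measure lborel (ball 0 1)) borel (\<lambda>x. x /\<^sub>R norm x)"

text \<open>The standing regularity assumptions: \<open>\<Sigma>\<close> is positive definite, and \<open>X\<close> has the law of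
  \<open>\<mu> + \<xi> R U\<close>, where \<open>R\<close> is the (unique) positive definite square root of \<open>\<Sigma>\<close>, \<open>U\<close> is uniform on
  the unit sphere and \<open>\<xi> \<ge> 0\<close> is independent of \<open>U\<close> with second moment in \<open>(0, \<infinity>)\<close>.
  The measure \<open>\<nu>\<close> is the law of \<open>\<xi>\<close>; the product measure encodes the independence.\<close>

definition regular_elliptical ::
    "'w measure \<Rightarrow> ('w \<Rightarrow> real ^ 'd) \<Rightarrow> real ^ 'd \<Rightarrow> real ^ 'd ^ 'd \<Rightarrow> bool" where
  "regular_elliptical M X \<mu> \<Sigma> \<longleftrightarrow>
     elliptical M X \<mu> \<Sigma> \<and> positive_definite \<Sigma> \<and>
     (\<exists>R \<nu>. positive_definite R \<and> R ** R = \<Sigma> \<and>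
        prob_space \<nu> \<and> sets \<nu> = sets (borel :: real measure) \<and> (AE r in \<nu>. 0 \<le> r) \<and>
        integrable \<nu> (\<lambda>r. r\<^sup>2) \<and> 0 < (LINT r|\<nu>. r\<^sup>2) \<and>
        distr M borel X =
          distr (\<nu> \<Otimes>\<^sub>M uniform_sphere) borel (\<lambda>(r, u). \<mu> + r *\<^sub>R (R *v u)))"

definition transelliptical ::
    "'w measure \<Rightarrow> ('w \<Rightarrow> real ^ 'd) \<Rightarrow> real ^ 'd \<Rightarrow> real ^ 'd ^ 'd \<Rightarrow> bool" where
  "transelliptical M Y \<mu> \<Sigma> \<longleftrightarrow>
     Y \<in> borel_measurable M \<and>
     (\<exists>f :: 'd \<Rightarrow> real \<Rightarrow> real. (\<forall>k. strict_mono (f k)) \<and>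
        regular_elliptical M (\<lambda>\<omega>. \<chi> k. f k (Y \<omega> $ k)) \<mu> \<Sigma>)"

text \<open>Continuity of all marginal distribution functions, i.e. no coordinate has ties.\<close>

definition continuous_random_vector :: "'w measure \<Rightarrow> ('w \<Rightarrow> real ^ 'd) \<Rightarrow> bool" where
  "continuous_random_vector M Y \<longleftrightarrow>
     (\<forall>k y. measure M {\<omega> \<in> space M. Y \<omega> $ k = y} = 0)"


section \<open>Conditional Kendall correlation\<close>

text \<open>The vector with the coordinates \<open>i\<close>, \<open>j\<close> removed, as an element of the product space over the
  remaining indices. If there are no other indices, this space has a single point.\<close>

definition drop_coords :: "'d \<Rightarrow> 'd \<Rightarrow> real ^ 'd \<Rightarrow> ('d \<Rightarrow> real)" where
  "drop_coords i j y = restrict (\<lambda>k. y $ k) (- {i, j})"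

definition regular_conditional_distribution ::
    "'w measure \<Rightarrow> 'a measure \<Rightarrow> 'b measure \<Rightarrow> ('w \<Rightarrow> 'a) \<Rightarrow> ('w \<Rightarrow> 'b) \<Rightarrow> ('a \<Rightarrow> 'b measure) \<Rightarrow> bool"
  where
  "regular_conditional_distribution M S T Z W \<kappa> \<longleftrightarrow>
     \<kappa> \<in> measurable S (prob_algebra T) \<and>
     (\<forall>A \<in> sets S. \<forall>B \<in> sets T.
        emeasure M {\<omega> \<in> space M. Z \<omega> \<in> A \<and> W \<omega> \<in> B} =
          (\<integral>\<^sup>+ z \<in> A. emeasure (\<kappa> z) B \<partial>distr M S Z))"

definition covariance :: "'a measure \<Rightarrow> ('a \<Rightarrow> real) \<Rightarrow> ('a \<Rightarrow> real) \<Rightarrow> real" where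
  "covariance P U V = (LINT x|P. (U x - (LINT y|P. U y)) * (V x - (LINT y|P. V y)))"

definition correlation :: "'a measure \<Rightarrow> ('a \<Rightarrow> real) \<Rightarrow> ('a \<Rightarrow> real) \<Rightarrow> real" where
  "correlation P U V = covariance P U V / sqrt (covariance P U U * covariance P V V)"

text \<open>Kendall's tau of a bivariate law \<open>P\<close>; under \<open>P \<Otimes>\<^sub>M P\<close> the two coordinates are independent
  copies \<open>(A, B)\<close> and \<open>(A', B')\<close> distributed as \<open>P\<close>.\<close>

definition kendall_tau :: "(real \<times> real) measure \<Rightarrow> real" where
  "kendall_tau P =
     correlation (P \<Otimes>\<^sub>M P) (\<lambda>(p, p'). sgn (fst p - fst p')) (\<lambda>(p, p'). sgn (snd p - snd p'))"

text \<open>If \<open>\<kappa> z\<close> is the conditional law of \<open>(V, W)\<close> given \<open>Z = z\<close>, this is the conditional Kendall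
  correlation of \<open>(g V, h W)\<close> given \<open>Z = z\<close>: the inner measure is the conditional law of
  \<open>(g V, h W)\<close>.\<close>

definition cond_kendall_tau ::
    "('a \<Rightarrow> (real \<times> real) measure) \<Rightarrow> (real \<Rightarrow> real) \<Rightarrow> (real \<Rightarrow> real) \<Rightarrow> 'a \<Rightarrow> real" where
  "cond_kendall_tau \<kappa> g h z = kendall_tau (distr (\<kappa> z) borel (map_prod g h))"

end

theory Submission
  imports Defs
begin

text \<open>Write \<open>X\<close> for the elliptical vector \<open>(f\<^sub>1(Y\<^sub>1), \<dots>, f\<^sub>d(Y\<^sub>d))\<close>. No density, conditional covariance
or arcsine formula enters; the whole argument is by symmetry.

The law of \<open>X\<close> is invariant under every linear isometry of the form \<open>x \<bullet> K x\<close>, because in the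
coordinates \<open>R\<^sup>-\<^sup>1 x\<close> such a map is orthogonal and the uniform law on the sphere is rotation invariant
(\<open>regular_elliptical_law_invariant\<close>). The reflection \<open>x - 2 (v \<bullet> K x / v \<bullet> K v) v\<close> along a vector \<open>v\<close> of
the coordinate plane spanned by the directions \<open>i\<close> and \<open>j\<close> is such an isometry, and it leaves all other
coordinates alone. Hence almost every conditional law of \<open>X\<close> given the other coordinates is invariant
under it (\<open>conditional_law_isometry_invariant\<close>), even simultaneously for countably many \<open>v\<close>.

Kendall's tau vanishes iff the mean of \<open>sgn D\<^sub>i * sgn D\<^sub>j\<close> does, where \<open>D\<close> is the difference of two
independent copies; increasing transformations of the coordinates do not change the signs. So everything
is decided by this mean (\<open>concordance\<close>) for a fixed conditional law of \<open>X\<close>. The reflection along axis \<open>i\<close>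
replaces \<open>D\<^sub>i\<close> by \<open>c D\<^sub>j - D\<^sub>i\<close> with \<open>c = - 2 K\<^sub>i\<^sub>j / K\<^sub>i\<^sub>i\<close> and fixes \<open>D\<^sub>j\<close>.

  \<^item> If \<open>K\<^sub>i\<^sub>j = 0\<close>, it changes the sign of \<open>D\<^sub>i\<close> only, so the mean equals its own negative.

  \<^item> If \<open>K\<^sub>i\<^sub>j \<noteq> 0\<close>, twice the mean is the mean of \<open>(sgn D\<^sub>i + sgn (c D\<^sub>j - D\<^sub>i)) * sgn D\<^sub>j\<close>, an expression that
    never has the sign opposite to \<open>c\<close> and is nonzero on an open cone of the plane. Were the mean zero,
    \<open>D\<close> would almost surely avoid the cone. By invariance it would also avoid the preimages of the cone
    under a dense countable set of reflections, and these cover the plane without the origin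
    (\<open>form_reflection_meets_open_cone\<close>). Then \<open>D = 0\<close>, so the conditional law is a point mass at a
    point fixed by the reflection along axis \<open>i\<close>, where \<open>(K x)\<^sub>i = 0\<close>.

The last possibility is excluded: some reflection carries \<open>X\<^sub>i\<close> to a nonzero multiple of \<open>(K X)\<^sub>i\<close>, and
\<open>X\<^sub>i\<close> has no atom at \<open>0\<close> since \<open>Y\<^sub>i\<close> has no atoms.\<close>

section \<open>Measurability and almost sure statements\<close>

lemma vec_nth_borel_measurable [measurable]: "(\<lambda>x :: real ^ 'd. x $ k) \<in> borel_measurable borel"
  by (intro borel_measurable_continuous_onI continuous_intros)

lemma linear_borel_measurable:
  fixes f :: "'a::euclidean_space \<Rightarrow> 'b::euclidean_space"
  shows "linear f \<Longrightarrow> f \<in> borel_measurable borel"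
  by (intro borel_measurable_continuous_onI linear_continuous_on) (simp add: linear_linear)

lemma borel_measurable_vec_lambda:
  fixes F :: "'d::finite \<Rightarrow> 'a \<Rightarrow> real"
  assumes "\<And>k. F k \<in> borel_measurable M"
  shows "(\<lambda>x. \<chi> k. F k x) \<in> borel_measurable M"
  by (subst borel_measurable_euclidean_space) (use assms in \<open>auto simp: Basis_vec_def inner_axis\<close>)

lemma fst_snd_borel_measurable [measurable]:
  "(fst :: real \<times> real \<Rightarrow> real) \<in> borel_measurable borel"
  "(snd :: real \<times> real \<Rightarrow> real) \<in> borel_measurable borel"
  by (simp_all flip: borel_prod)

lemma strict_mono_borel_measurable: "strict_mono f \<Longrightarrow> (f :: real \<Rightarrow> real) \<in> borel_measurable borel"
  by (intro borel_measurable_mono strict_mono_mono)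

text \<open>The increasing function \<open>f\<close> may jump, so its range can be complicated; the generalised inverse
\<open>Sup {y. f y \<le> x}\<close> is monotone, hence Borel. It is taken after \<open>arctan\<close> so that the supremum exists
for every \<open>x\<close>.\<close>

lemma strict_mono_measurable_left_inverse:
  fixes f :: "real \<Rightarrow> real"
  assumes "strict_mono f"
  obtains g where "g \<in> borel_measurable borel" "\<And>x. g (f x) = x"
proof -
  define h where "h x = Sup (insert (- (pi / 2)) (arctan ` {y. f y \<le> x}))" for x
  have bdd: "bdd_above (insert (- (pi / 2)) (arctan ` {y. f y \<le> x}))" for x
    using arctan_ubound by (intro bdd_aboveI[of _ "pi / 2"]) (auto intro: less_imp_le)
  have "mono h"
    unfolding h_def by (intro monoI cSup_subset_mono bdd) auto
  then have [measurable]: "h \<in> borel_measurable borel"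
    by (rule borel_measurable_mono)
  have "h (f x) = arctan x" for x
    unfolding h_def
  proof (rule cSup_eq_maximum)
    show "arctan x \<in> insert (- (pi / 2)) (arctan ` {y. f y \<le> f x})" by simp
    fix z assume "z \<in> insert (- (pi / 2)) (arctan ` {y. f y \<le> f x})"
    then show "z \<le> arctan x"
      using strict_mono_less_eq[OF assms] arctan_lbound[of x] by (auto simp: arctan_le_iff)
  qed
  moreover have "(\<lambda>x. tan (h x)) \<in> borel_measurable borel"
    unfolding tan_def by measurable
  ultimately show thesis
    by (intro that[of "\<lambda>x. tan (h x)"]) (simp_all add: tan_arctan)
qed

lemma AE_distr_invariant:
  assumes "distr M M T = M" "T \<in> measurable M M" "AE x in M. Q x"
  shows "AE x in M. Q (T x)"
proof -
  have "AE x in distr M M T. Q x"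
    unfolding assms(1) by (rule assms(3))
  then show ?thesis
    by (rule AE_distrD[OF assms(2)])
qed

lemma AE_pair_fst_snd:
  assumes P: "prob_space P" and ae: "AE x in P. A x"
  shows "AE q in P \<Otimes>\<^sub>M P. A (fst q) \<and> A (snd q)"
proof -
  interpret P: prob_space P by fact
  interpret pair_sigma_finite P P ..
  have "AE x in distr (P \<Otimes>\<^sub>M P) P fst. A x"
    using ae by (simp only: P.distr_pair_fst)
  then have fst: "AE q in P \<Otimes>\<^sub>M P. A (fst q)"
    by (rule AE_distrD[rotated]) simp
  then have "AE q in distr (P \<Otimes>\<^sub>M P) (P \<Otimes>\<^sub>M P) (\<lambda>(x, y). (y, x)). A (fst q)"
    by (simp only: flip: distr_pair_swap)
  then have "AE q in P \<Otimes>\<^sub>M P. A (snd q)"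
    by (drule_tac AE_distrD[rotated]) (auto simp: case_prod_unfold)
  with fst show ?thesis by eventually_elim simp
qed

lemma distr_pair_invariant:
  assumes P: "prob_space P" and T: "T \<in> measurable P P" "distr P P T = P"
    and U: "U \<in> measurable P P" "distr P P U = P"
  shows "distr (P \<Otimes>\<^sub>M P) (P \<Otimes>\<^sub>M P) (\<lambda>(x, y). (T x, U y)) = P \<Otimes>\<^sub>M P"
  using pair_measure_distr[OF T(1) U(1)] prob_space.axioms(1)[OF P] T U
  by (simp add: finite_measure_def)

section \<open>Kendall's tau as a mean product of signs\<close>

text \<open>The probability of concordance minus that of discordance for two independent draws from \<open>P\<close>.\<close>

definition concordance :: "'a measure \<Rightarrow> ('a \<Rightarrow> real) \<Rightarrow> ('a \<Rightarrow> real) \<Rightarrow> real" where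
  "concordance P F G = (LINT (p, p')|(P \<Otimes>\<^sub>M P). sgn (F p - F p') * sgn (G p - G p'))"

lemma concordance_distr:
  assumes "prob_space P" and T [measurable]: "T \<in> measurable P N"
    and F [measurable]: "F \<in> borel_measurable N" and G [measurable]: "G \<in> borel_measurable N"
  shows "concordance (distr P N T) F G = concordance P (\<lambda>x. F (T x)) (\<lambda>x. G (T x))"
proof -
  interpret P: prob_space P by fact
  interpret D: prob_space "distr P N T" by (rule P.prob_space_distr) simp
  have "distr P N T \<Otimes>\<^sub>M distr P N T = distr (P \<Otimes>\<^sub>M P) (N \<Otimes>\<^sub>M N) (\<lambda>(x, y). (T x, T y))"
    by (rule pair_measure_distr) (auto intro: D.sigma_finite_measure)
  then show ?thesis
    unfolding concordance_def by (simp add: integral_distr case_prod_unfold)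
qed

lemma concordance_strict_mono:
  assumes "strict_mono g" "strict_mono h"
  shows "concordance P (\<lambda>x. g (F x)) (\<lambda>x. h (G x)) = concordance P F G"
proof -
  have "sgn (f x - f y) = sgn (x - y)" if "strict_mono f" for f :: "real \<Rightarrow> real" and x y
    using that strict_mono_less[OF that, of x y] strict_mono_less[OF that, of y x]
    by (auto simp: sgn_if)
  with assms show ?thesis
    by (simp add: concordance_def)
qed

text \<open>The two copies are exchangeable, and exchanging them changes the sign of the integrand.\<close>

lemma integral_sgn_difference_eq_0:
  fixes F :: "'a \<Rightarrow> real"
  assumes "prob_space P" and [measurable]: "F \<in> borel_measurable P"
  shows "(LINT (p, p')|(P \<Otimes>\<^sub>M P). sgn (F p - F p')) = 0"
proof -
  interpret P: prob_space P by fact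
  interpret pair_sigma_finite P P ..
  have "(LINT (p, p')|(P \<Otimes>\<^sub>M P). sgn (F p - F p'))
      = (LINT (p, p')|(P \<Otimes>\<^sub>M P). sgn (F p' - F p))"
    using integral_product_swap[of "\<lambda>(p, p'). sgn (F p - F p')"] by simp
  also have "\<dots> = (LINT (p, p')|(P \<Otimes>\<^sub>M P). - sgn (F p - F p'))"
    by (intro Bochner_Integration.integral_cong) (auto simp: sgn_if)
  finally show ?thesis
    by (simp add: case_prod_unfold)
qed

text \<open>The denominator of the correlation can vanish, in which case the quotient is \<open>0\<close>; this is harmless,
because a centred variable of variance \<open>0\<close> is almost surely \<open>0\<close>, which makes the covariance \<open>0\<close> too.\<close>

lemma correlation_centred_eq_0_iff:
  assumes "prob_space P" and [measurable]: "U \<in> borel_measurable P" "V \<in> borel_measurable P"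
    and bounded: "\<And>x. \<bar>U x\<bar> \<le> B" "\<And>x. \<bar>V x\<bar> \<le> B"
    and centred: "(LINT x|P. U x) = 0" "(LINT x|P. V x) = 0"
  shows "correlation P U V = 0 \<longleftrightarrow> (LINT x|P. U x * V x) = 0"
proof -
  interpret P: prob_space P by fact
  have bound: "\<bar>f x * g x\<bar> \<le> B * B" if "\<And>x. \<bar>f x\<bar> \<le> B" "\<And>x. \<bar>g x\<bar> \<le> B" for f g :: "'a \<Rightarrow> real" and x
    unfolding abs_mult using that[of x] by (intro mult_mono) (auto intro: order_trans[OF abs_ge_zero])
  have null: "(LINT x|P. f x * g x) = 0"
    if [measurable]: "f \<in> borel_measurable P" "g \<in> borel_measurable P"
      and f: "\<And>x. \<bar>f x\<bar> \<le> B" and z: "(LINT x|P. f x * f x) = 0" for f g :: "'a \<Rightarrow> real"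
  proof -
    have "integrable P (\<lambda>x. f x * f x)"
      by (rule P.integrable_const_bound[where B="B * B"]) (use bound[of f f] f in \<open>auto simp: abs_le_iff\<close>)
    then have "AE x in P. f x * f x = 0"
      using z by (subst (asm) integral_nonneg_eq_0_iff_AE) auto
    then have "(LINT x|P. f x * g x) = (LINT x|P. 0)"
      by (intro integral_cong_AE) auto
    then show ?thesis by simp
  qed
  show ?thesis
    using null[of U V] null[of V U] bounded
    by (auto simp: correlation_def covariance_def centred mult.commute)
qed

lemma kendall_tau_distr_eq_0_iff:
  assumes P: "prob_space P" and [measurable]: "F \<in> borel_measurable P" "G \<in> borel_measurable P"
  shows "kendall_tau (distr P borel (\<lambda>x. (F x, G x))) = 0 \<longleftrightarrow> concordance P F G = 0"
proof -
  let ?D = "distr P borel (\<lambda>x. (F x, G x))"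
  interpret P: prob_space P by fact
  have D: "prob_space ?D" by (rule P.prob_space_distr) simp
  interpret D: prob_space ?D by fact
  interpret DD: pair_prob_space ?D ?D ..
  have "kendall_tau ?D = 0 \<longleftrightarrow> (LINT q|(?D \<Otimes>\<^sub>M ?D).
      (case q of (p, p') \<Rightarrow> sgn (fst p - fst p')) * (case q of (p, p') \<Rightarrow> sgn (snd p - snd p'))) = 0"
    unfolding kendall_tau_def
  proof (rule correlation_centred_eq_0_iff[where B=1])
    show "(LINT (p, p')|(?D \<Otimes>\<^sub>M ?D). sgn (fst p - fst p')) = 0"
      by (rule integral_sgn_difference_eq_0[OF D]) simp
    show "(LINT (p, p')|(?D \<Otimes>\<^sub>M ?D). sgn (snd p - snd p')) = 0"
      by (rule integral_sgn_difference_eq_0[OF D]) simp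
  qed (auto simp: sgn_if DD.prob_space_axioms split: prod.split)
  also have "\<dots> \<longleftrightarrow> concordance ?D fst snd = 0"
    by (simp add: concordance_def case_prod_unfold)
  also have "concordance ?D fst snd = concordance P F G"
    by (subst concordance_distr[OF P]) simp_all
  finally show ?thesis .
qed

lemma cond_kendall_tau_eq_0_iff_concordance:
  assumes P: "prob_space (\<kappa> z)" "sets (\<kappa> z) = sets borel" and gh: "strict_mono g" "strict_mono h"
  shows "cond_kendall_tau \<kappa> g h z = 0 \<longleftrightarrow> concordance (\<kappa> z) fst snd = 0"
proof -
  note [measurable_cong] = P(2)
  note [measurable] = strict_mono_borel_measurable[OF gh(1)] strict_mono_borel_measurable[OF gh(2)]
  have "map_prod g h = (\<lambda>w. (g (fst w), h (snd w)))" by auto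
  then show ?thesis
    unfolding cond_kendall_tau_def
    by (simp add: kendall_tau_distr_eq_0_iff[OF P(1)] concordance_strict_mono[OF gh])
qed

section \<open>Reflections in a quadratic form\<close>

definition form_reflection :: "real ^ 'd ^ 'd \<Rightarrow> real ^ 'd \<Rightarrow> real ^ 'd \<Rightarrow> real ^ 'd" where
  "form_reflection K v x = x - (2 * (v \<bullet> (K *v x)) / (v \<bullet> (K *v v))) *\<^sub>R v"

lemma positive_definite_pos:
  "positive_definite K \<Longrightarrow> x \<noteq> 0 \<Longrightarrow> 0 < x \<bullet> (K *v x)"
  by (simp add: positive_definite_def)

lemma positive_definite_commute:
  "positive_definite K \<Longrightarrow> x \<bullet> (K *v y) = y \<bullet> (K *v x)"
  by (metis dot_lmul_matrix inner_commute positive_definite_def transpose_matrix_vector)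

lemma linear_form_reflection: "linear (form_reflection K v)"
  by (rule linearI)
    (simp_all add: form_reflection_def matrix_vector_right_distrib matrix_vector_mult_scaleR
      inner_add_right algebra_simps add_divide_distrib)

lemma form_reflection_zero [simp]: "form_reflection K 0 x = x"
  by (simp add: form_reflection_def)

lemma form_reflection_selfadjoint:
  assumes "positive_definite K"
  shows "form_reflection K v x \<bullet> (K *v y) = x \<bullet> (K *v form_reflection K v y)"
  using positive_definite_commute[OF assms, of v x]
  by (simp add: form_reflection_def inner_diff_left inner_diff_right
      matrix_vector_mult_diff_distrib matrix_vector_mult_scaleR)

lemma form_reflection_involution:
  assumes "positive_definite K"
  shows "form_reflection K v (form_reflection K v x) = x"
  using positive_definite_pos[OF assms, of v]
  by (cases "v = 0")
    (simp_all add: form_reflection_def inner_diff_right matrix_vector_mult_diff_distrib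
      matrix_vector_mult_scaleR field_simps flip: scaleR_add_left scaleR_diff_left)

lemma form_reflection_isometry:
  assumes "positive_definite K"
  shows "form_reflection K v x \<bullet> (K *v form_reflection K v x) = x \<bullet> (K *v x)"
  by (simp add: form_reflection_selfadjoint[OF assms] form_reflection_involution[OF assms])

text \<open>The reflecting hyperplane is the perpendicular bisector of \<open>x\<close> and \<open>y\<close> in the geometry of \<open>K\<close>. Thus the
reflections act transitively on the vectors of given \<open>K\<close>-length, which is what both applications use.\<close>

lemma form_reflection_exchange:
  assumes K: "positive_definite K" and eq: "x \<bullet> (K *v x) = y \<bullet> (K *v y)"
  shows "form_reflection K (x - y) x = y"
proof (cases "x = y")
  case False
  then have "0 < (x - y) \<bullet> (K *v (x - y))"
    using positive_definite_pos[OF K, of "x - y"] by simp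
  moreover have "(x - y) \<bullet> (K *v (x - y)) = 2 * ((x - y) \<bullet> (K *v x))"
    using eq positive_definite_commute[OF K, of x y]
    by (simp add: matrix_vector_mult_diff_distrib inner_diff_left inner_diff_right)
  ultimately show ?thesis
    by (simp add: form_reflection_def)
qed simp

text \<open>Scaling the vector \<open>u\<close> of the cone to the \<open>K\<close>-length of \<open>d\<close>, the reflection along \<open>w = d - r u\<close> moves
\<open>d\<close> into the open cone; as the reflection depends continuously on its axis \<open>w \<noteq> 0\<close>, an axis from the dense
set \<open>V\<close> does as well. Continuity fails at \<open>w = 0\<close>, that is \<open>d = r u\<close>, but there \<open>d\<close> is in the cone
already and the axis \<open>0\<close>, which stands for the identity map, is adjoined to \<open>V\<close>.\<close>

lemma form_reflection_meets_open_cone: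
  assumes K: "positive_definite K" and L: "subspace L" and V: "L \<subseteq> closure V"
    and C: "open C" "u \<in> C" "u \<in> L" "\<And>r x. 0 < r \<Longrightarrow> x \<in> C \<Longrightarrow> r *\<^sub>R x \<in> C"
    and d: "d \<in> L" "d \<noteq> 0" and u: "u \<noteq> 0"
  shows "\<exists>v\<in>insert 0 V. form_reflection K v d \<in> C"
proof -
  define r where "r = sqrt (d \<bullet> (K *v d) / (u \<bullet> (K *v u)))"
  have pos: "0 < d \<bullet> (K *v d)" "0 < u \<bullet> (K *v u)"
    using positive_definite_pos[OF K] d u by auto
  then have r: "0 < r" "r\<^sup>2 = d \<bullet> (K *v d) / (u \<bullet> (K *v u))"
    by (simp_all add: r_def)
  have inC: "r *\<^sub>R u \<in> C" using C r by auto
  have "(r *\<^sub>R u) \<bullet> (K *v (r *\<^sub>R u)) = r\<^sup>2 * (u \<bullet> (K *v u))"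
    by (simp add: matrix_vector_mult_scaleR power2_eq_square)
  then have eq: "d \<bullet> (K *v d) = (r *\<^sub>R u) \<bullet> (K *v (r *\<^sub>R u))"
    using pos r by simp
  define w where "w = d - r *\<^sub>R u"
  have w: "form_reflection K w d \<in> C" "w \<in> L"
    using form_reflection_exchange[OF K eq] inC L d C by (simp_all add: w_def subspace_diff subspace_scale)
  show ?thesis
  proof (cases "w = 0")
    case True
    then show ?thesis using w by auto
  next
    case False
    have "isCont (\<lambda>v. form_reflection K v d) w"
      unfolding form_reflection_def
      using positive_definite_pos[OF K False]
      by (intro continuous_intros continuous_at_imp_continuous_within linear_continuous_at
          matrix_vector_mul_bounded_linear) auto
    then have "\<forall>\<^sub>F v in at w. form_reflection K v d \<in> C"
      using w C by (auto simp: isCont_def dest: topological_tendstoD)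
    then have "\<forall>\<^sub>F v in nhds w. form_reflection K v d \<in> C"
      using w by (simp add: eventually_nhds_conv_at)
    then obtain N where "open N" "w \<in> N" "\<And>v. v \<in> N \<Longrightarrow> form_reflection K v d \<in> C"
      by (auto simp: eventually_nhds)
    moreover have "w \<in> closure V" using w V by auto
    ultimately show ?thesis
      by (meson IntE closure_iff_nhds_not_empty disjoint_iff insertI2 order_refl)
  qed
qed

lemma positive_definite_diagonal_pos: "positive_definite K \<Longrightarrow> 0 < K $ i $ i"
  using positive_definite_pos[of K "axis i 1"] by (simp add: inner_axis' matrix_vector_mul_component axis_eq_0_iff inner_axis)

lemma form_reflection_axis:
  "form_reflection K (axis i 1) x = x - (2 * (K *v x) $ i / K $ i $ i) *\<^sub>R axis i 1"
  by (simp add: form_reflection_def inner_axis' matrix_vector_mul_component inner_axis)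

lemma matrix_vector_mult_coordinate_plane:
  fixes d :: "real ^ 'd"
  assumes "i \<noteq> j" "\<forall>k. k \<noteq> i \<and> k \<noteq> j \<longrightarrow> d $ k = 0"
  shows "(K *v d) $ l = K $ l $ i * d $ i + K $ l $ j * d $ j"
proof -
  have "(K *v d) $ l = (\<Sum>k\<in>UNIV. K $ l $ k * d $ k)"
    by (simp add: matrix_vector_mult_def)
  also have "\<dots> = (\<Sum>k\<in>{i, j}. K $ l $ k * d $ k)"
    using assms(2) by (intro sum.mono_neutral_right) auto
  finally show ?thesis
    using assms(1) by simp
qed

lemma subspace_coordinate_plane: "subspace {d :: real ^ 'd. \<forall>k. k \<noteq> i \<and> k \<noteq> j \<longrightarrow> d $ k = 0}"
  by (auto simp: subspace_def)

text \<open>Differences of points with equal remaining coordinates lie in the coordinate plane, so only the entries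
\<open>K\<^sub>i\<^sub>i\<close> and \<open>K\<^sub>i\<^sub>j\<close> of row \<open>i\<close> act on them.\<close>

lemma form_reflection_axis_differences:
  assumes "i \<noteq> j" and K: "positive_definite K" and plane: "\<forall>k. k \<noteq> i \<and> k \<noteq> j \<longrightarrow> p $ k = p' $ k"
  shows "form_reflection K (axis i 1) p $ i - form_reflection K (axis i 1) p' $ i =
      - 2 * (K $ i $ j / K $ i $ i) * (p $ j - p' $ j) - (p $ i - p' $ i)"
    and "form_reflection K (axis i 1) p $ j = p $ j"
proof -
  have "form_reflection K (axis i 1) p $ i - form_reflection K (axis i 1) p' $ i
      = form_reflection K (axis i 1) (p - p') $ i"
    by (simp add: linear_diff[OF linear_form_reflection])
  also have "\<dots> = (p - p') $ i - 2 * (K $ i $ i * (p - p') $ i + K $ i $ j * (p - p') $ j) / K $ i $ i"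
    by (simp only: form_reflection_axis matrix_vector_mult_coordinate_plane[OF assms(1), of "p - p'"] plane vector_minus_component
      vector_scaleR_component axis_nth) (simp add: plane matrix_vector_mult_coordinate_plane[OF assms(1)])
  also have "\<dots> = - 2 * (K $ i $ j / K $ i $ i) * (p $ j - p' $ j) - (p $ i - p' $ i)"
    using positive_definite_diagonal_pos[OF K, of i] by (simp add: field_simps)
  finally show "form_reflection K (axis i 1) p $ i - form_reflection K (axis i 1) p' $ i =
      - 2 * (K $ i $ j / K $ i $ i) * (p $ j - p' $ j) - (p $ i - p' $ i)" .
  show "form_reflection K (axis i 1) p $ j = p $ j"
    unfolding form_reflection_axis using assms(1) by (simp add: axis_def)
qed

lemma positive_definite_matrix_inv:
  fixes A :: "real ^ 'd ^ 'd"
  assumes "positive_definite A"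
  shows "A ** matrix_inv A = mat 1" "matrix_inv A ** A = mat 1" "positive_definite (matrix_inv A)"
proof -
  have "\<forall>x. A *v x = 0 \<longrightarrow> x = 0"
    using positive_definite_pos[OF assms] by force
  then obtain B where "B ** A = mat 1"
    using matrix_left_invertible_ker[of A] by blast
  then have "\<exists>B. A ** B = mat 1 \<and> B ** A = mat 1"
    using matrix_left_right_inverse by blast
  then have "A ** matrix_inv A = mat 1 \<and> matrix_inv A ** A = mat 1"
    unfolding matrix_inv_def by (rule someI_ex)
  then show inv: "A ** matrix_inv A = mat 1" "matrix_inv A ** A = mat 1"
    by simp_all
  let ?K = "matrix_inv A"
  have "transpose ?K ** A = mat 1"
    using assms arg_cong[OF inv(1), of transpose]
    by (simp add: matrix_transpose_mul positive_definite_def transpose_mat)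
  then have "transpose ?K = ?K"
    using matrix_mul_assoc[of "transpose ?K" A ?K] by (simp add: inv(1))
  moreover have "0 < x \<bullet> (?K *v x)" if "x \<noteq> 0" for x
  proof -
    define y where "y = ?K *v x"
    have x: "x = A *v y" by (simp add: y_def matrix_vector_mul_assoc inv(1))
    with that have "y \<noteq> 0" by auto
    then have "0 < y \<bullet> x"
      unfolding x by (rule positive_definite_pos[OF assms])
    then show ?thesis by (simp add: y_def inner_commute)
  qed
  ultimately show "positive_definite ?K" by (simp add: positive_definite_def)
qed

section \<open>Laws invariant under reflections in a coordinate plane\<close>

text \<open>Both copies are reflected along axis \<open>i\<close>, which preserves their joint law. The hypothesis \<open>plane\<close> says that
\<open>P\<close> lives on a translate of the plane of the directions \<open>i\<close> and \<open>j\<close>, as the conditional laws do.\<close>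

lemma concordance_eq_reflected:
  fixes P :: "(real ^ 'd) measure"
  assumes P: "prob_space P" and sets [measurable_cong]: "sets P = sets borel"
    and K: "positive_definite K" and ij: "i \<noteq> j"
    and plane: "AE x in P. \<forall>k. k \<noteq> i \<and> k \<noteq> j \<longrightarrow> x $ k = c k"
    and inv: "distr P P (form_reflection K (axis i 1)) = P"
  shows "concordance P (\<lambda>x. x $ i) (\<lambda>x. x $ j) =
    (LINT (p, p')|(P \<Otimes>\<^sub>M P).
      sgn (- 2 * (K $ i $ j / K $ i $ i) * (p $ j - p' $ j) - (p $ i - p' $ i)) * sgn (p $ j - p' $ j))"
    (is "_ = ?R")
proof -
  let ?S = "form_reflection K (axis i 1)"
  have [measurable]: "?S \<in> borel_measurable borel"
    by (rule linear_borel_measurable[OF linear_form_reflection])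
  have "concordance P (\<lambda>x. x $ i) (\<lambda>x. x $ j) = concordance (distr P P ?S) (\<lambda>x. x $ i) (\<lambda>x. x $ j)"
    by (simp only: inv)
  also have "\<dots> = concordance P (\<lambda>x. ?S x $ i) (\<lambda>x. ?S x $ j)"
    by (rule concordance_distr[OF P]) measurable
  also have "\<dots> = ?R"
    unfolding concordance_def
  proof (rule integral_cong_AE)
    show "AE q in P \<Otimes>\<^sub>M P. (case q of (p, p') \<Rightarrow> sgn (?S p $ i - ?S p' $ i) * sgn (?S p $ j - ?S p' $ j))
      = (case q of (p, p') \<Rightarrow> sgn (- 2 * (K $ i $ j / K $ i $ i) * (p $ j - p' $ j) - (p $ i - p' $ i))
          * sgn (p $ j - p' $ j))"
      using AE_pair_fst_snd[OF P plane]
    proof eventually_elim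
      case (elim q)
      then have "\<forall>k. k \<noteq> i \<and> k \<noteq> j \<longrightarrow> fst q $ k = snd q $ k" by simp
      note form_reflection_axis_differences[OF ij K this]
        form_reflection_axis_differences(2)[OF ij K, of "snd q" "snd q"]
      then show ?case by (simp only: case_prod_unfold) simp
    qed
  qed measurable
  finally show ?thesis .
qed

text \<open>With \<open>K\<^sub>i\<^sub>j = 0\<close> the reflection changes the sign of one factor and keeps the other.\<close>

lemma concordance_eq_0_if_uncoupled:
  fixes P :: "(real ^ 'd) measure"
  assumes P: "prob_space P" "sets P = sets borel"
    and K: "positive_definite K" and ij: "i \<noteq> j"
    and plane: "AE x in P. \<forall>k. k \<noteq> i \<and> k \<noteq> j \<longrightarrow> x $ k = c k"
    and inv: "distr P P (form_reflection K (axis i 1)) = P"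
    and zero: "K $ i $ j = 0"
  shows "concordance P (\<lambda>x. x $ i) (\<lambda>x. x $ j) = 0"
proof -
  have "concordance P (\<lambda>x. x $ i) (\<lambda>x. x $ j) =
    (LINT (p, p')|(P \<Otimes>\<^sub>M P). - (sgn (p $ i - p' $ i) * sgn (p $ j - p' $ j)))"
    unfolding concordance_eq_reflected[OF P K ij plane inv] zero
    by (intro Bochner_Integration.integral_cong) (auto simp: sgn_if)
  also have "\<dots> = - concordance P (\<lambda>x. x $ i) (\<lambda>x. x $ j)"
    by (simp add: concordance_def case_prod_unfold)
  finally show ?thesis by simp
qed

text \<open>For \<open>t = c D\<^sub>j\<close> and \<open>x = D\<^sub>i\<close>: the numbers \<open>x\<close> and \<open>t - x\<close> sum to \<open>t\<close>, so they cannot both have the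
opposite sign, and the expression is \<open>2\<close> when both have the sign of \<open>t\<close>.\<close>

lemma sign_pair:
  fixes t x :: real
  shows "0 \<le> sgn t * (sgn x + sgn (t - x))"
    and "0 < t * x \<Longrightarrow> 0 < t * (t - x) \<Longrightarrow> sgn t * (sgn x + sgn (t - x)) \<noteq> 0"
  by (auto simp: sgn_if zero_less_mult_iff)

text \<open>A coupled law (\<open>K\<^sub>i\<^sub>j \<noteq> 0\<close>) with enough symmetry has zero concordance only if it is degenerate; the
degeneracy is recorded as an event of the vector alone, free of the conditioning value, so that
its unconditional probability can refute it.\<close>

lemma precision_row_eq_0_if_concordance_eq_0:
  fixes P :: "(real ^ 'd) measure"
  assumes P: "prob_space P" and sets [measurable_cong]: "sets P = sets borel"
    and K: "positive_definite K" and ij: "i \<noteq> j"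
    and plane: "AE x in P. \<forall>k. k \<noteq> i \<and> k \<noteq> j \<longrightarrow> x $ k = c k"
    and V: "countable V" "{d. \<forall>k. k \<noteq> i \<and> k \<noteq> j \<longrightarrow> d $ k = 0} \<subseteq> closure V"
    and inv: "\<And>v. v \<in> insert (axis i 1) V \<Longrightarrow> distr P P (form_reflection K v) = P"
    and nonzero: "K $ i $ j \<noteq> 0"
    and conc: "concordance P (\<lambda>x. x $ i) (\<lambda>x. x $ j) = 0"
  shows "AE x in P. (K *v x) $ i = 0"
proof -
  interpret P: prob_space P by fact
  interpret PP: pair_prob_space P P ..
  let ?S = "form_reflection K (axis i 1)"
  have S [measurable]: "form_reflection K v \<in> borel_measurable borel" for v
    by (rule linear_borel_measurable[OF linear_form_reflection])
  have S' [measurable]: "form_reflection K v \<in> measurable P P" for v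
    by measurable
  define c' where "c' = - 2 * (K $ i $ j / K $ i $ i)"
  have c': "c' \<noteq> 0"
    using nonzero positive_definite_diagonal_pos[OF K, of i] by (simp add: c'_def)
  define L where "L = {d :: real ^ 'd. \<forall>k. k \<noteq> i \<and> k \<noteq> j \<longrightarrow> d $ k = 0}"
  have L: "subspace L" "L \<subseteq> closure V"
    using subspace_coordinate_plane[of i j] V by (auto simp: L_def)
  \<comment> \<open>The cone on which both terms of the symmetrised integrand have the same nonzero sign.\<close>
  define C where "C = {d :: real ^ 'd. 0 < (c' * d $ j) * (d $ i) \<and> 0 < (c' * d $ j) * (c' * d $ j - d $ i)}"
  have "open C"
    unfolding C_def by (intro open_Collect_conj open_Collect_less continuous_intros)
  have cone: "r *\<^sub>R x \<in> C" if "0 < r" "x \<in> C" for r x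
  proof -
    have *: "(c' * (r *\<^sub>R x) $ j) * (r *\<^sub>R x) $ i = (r * r) * ((c' * x $ j) * x $ i)"
      "(c' * (r *\<^sub>R x) $ j) * (c' * (r *\<^sub>R x) $ j - (r *\<^sub>R x) $ i) =
        (r * r) * ((c' * x $ j) * (c' * x $ j - x $ i))"
      by (simp_all only: vector_scaleR_component real_scaleR_def) algebra+
    have pos: "0 < r * r" "0 < (c' * x $ j) * x $ i" "0 < (c' * x $ j) * (c' * x $ j - x $ i)"
      using that by (simp_all add: C_def)
    show ?thesis
      unfolding C_def mem_Collect_eq *
      using mult_pos_pos[OF pos(1,2)] mult_pos_pos[OF pos(1,3)] by blast
  qed
  \<comment> \<open>A point of the cone with \<open>x = t / 2\<close>, midway between the two bounding lines.\<close>
  define u where "u = axis i (c' / 2) + axis j (1 :: real)"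
  have u: "u \<in> C" "u \<in> L" "u \<noteq> 0"
  proof -
    have *: "u $ i = c' / 2" "u $ j = 1"
      using ij by (auto simp: u_def axis_def)
    have "0 < c' * c'"
      using c' by (metis not_real_square_gt_zero)
    then show "u \<in> C"
      by (simp add: C_def *)
    show "u \<in> L" by (auto simp: L_def u_def axis_def)
    show "u \<noteq> 0" using * by auto
  qed

  \<comment> \<open>The mean of the integrand symmetrised by the reflection, multiplied by the constant \<open>sgn
    c'\<close> to make it nonnegative.\<close>
  have sgn_sum: "(LINT q|(P \<Otimes>\<^sub>M P). sgn (c' * (fst q $ j - snd q $ j)) *
      (sgn (fst q $ i - snd q $ i) + sgn (c' * (fst q $ j - snd q $ j) - (fst q $ i - snd q $ i)))) = 0"
    (is "integral\<^sup>L _ ?f = 0")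
  proof -
    have "?f = (\<lambda>q. sgn c' * (sgn (fst q $ i - snd q $ i) * sgn (fst q $ j - snd q $ j))
       + sgn c' * (sgn (c' * (fst q $ j - snd q $ j) - (fst q $ i - snd q $ i)) * sgn (fst q $ j - snd q $ j)))"
      by (rule ext, simp only: sgn_mult, algebra)
    moreover have "integrable (P \<Otimes>\<^sub>M P) (\<lambda>q. sgn (fst q $ i - snd q $ i) * sgn (fst q $ j - snd q $ j))"
      by (rule PP.integrable_const_bound[where B=1]) (auto simp: sgn_if)
    moreover have "integrable (P \<Otimes>\<^sub>M P) (\<lambda>q. sgn (c' * (fst q $ j - snd q $ j) - (fst q $ i - snd q $ i)) *
        sgn (fst q $ j - snd q $ j))"
      by (rule PP.integrable_const_bound[where B=1]) (auto simp: sgn_if)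
    moreover have "(LINT q|(P \<Otimes>\<^sub>M P). sgn (fst q $ i - snd q $ i) * sgn (fst q $ j - snd q $ j)) = 0"
      using conc by (simp add: concordance_def case_prod_unfold)
    moreover have "(LINT q|(P \<Otimes>\<^sub>M P). sgn (c' * (fst q $ j - snd q $ j) - (fst q $ i - snd q $ i)) *
        sgn (fst q $ j - snd q $ j)) = 0"
      using conc concordance_eq_reflected[OF P sets K ij plane inv]
      by (simp add: case_prod_unfold c'_def)
    ultimately show ?thesis by simp
  qed
  have "AE q in P \<Otimes>\<^sub>M P. ?f q = 0"
  proof (subst integral_nonneg_eq_0_iff_AE[symmetric])
    show "integrable (P \<Otimes>\<^sub>M P) ?f"
      by (rule PP.integrable_const_bound[where B=2]) (auto simp: sgn_if)
  qed (use sgn_sum sign_pair(1) in auto)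
  then have notC: "AE q in P \<Otimes>\<^sub>M P. fst q - snd q \<notin> C"
    by eventually_elim (use sign_pair(2) in \<open>auto simp: C_def\<close>)
  have "AE q in P \<Otimes>\<^sub>M P. form_reflection K v (fst q - snd q) \<notin> C" if "v \<in> insert 0 V" for v
  proof (cases "v = 0")
    case False
    then have "distr P P (form_reflection K v) = P" using that inv by auto
    then have "distr (P \<Otimes>\<^sub>M P) (P \<Otimes>\<^sub>M P) (\<lambda>(x, y). (form_reflection K v x, form_reflection K v y)) = P \<Otimes>\<^sub>M P"
      using distr_pair_invariant[OF P S' _ S'] by auto
    from AE_distr_invariant[OF this _ notC] show ?thesis
      by (simp add: case_prod_unfold linear_diff[OF linear_form_reflection])
  qed (use notC in simp)
  then have "AE q in P \<Otimes>\<^sub>M P. \<forall>v\<in>insert 0 V. form_reflection K v (fst q - snd q) \<notin> C"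
    using V by (intro AE_ball_countable') auto
  with AE_pair_fst_snd[OF P plane] have eq: "AE q in P \<Otimes>\<^sub>M P. fst q = snd q"
  proof eventually_elim
    case (elim q)
    then have "fst q - snd q \<in> L" by (simp add: L_def)
    then show ?case
      using form_reflection_meets_open_cone[OF K L \<open>open C\<close> u(1,2) cone _ _ u(3)] elim by force
  qed
  \<comment> \<open>Reflecting only the first of the two copies turns \<open>p = p'\<close> into \<open>S p =
    p'\<close>, hence \<open>S p = p\<close>.\<close>
  have "distr P P (\<lambda>x. x) = P" by (simp add: distr_id2)
  then have "distr (P \<Otimes>\<^sub>M P) (P \<Otimes>\<^sub>M P) (\<lambda>(x, y). (?S x, y)) = P \<Otimes>\<^sub>M P"
    using distr_pair_invariant[OF P S', of "axis i 1" "\<lambda>x. x"] inv by simp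
  from AE_distr_invariant[OF this _ eq] have "AE q in P \<Otimes>\<^sub>M P. ?S (fst q) = snd q"
    by (simp add: case_prod_unfold)
  with eq have "AE q in P \<Otimes>\<^sub>M P. ?S (fst q) = fst q"
    by eventually_elim simp
  then have "AE x in P. AE y in P. ?S x = x"
    by (drule_tac PP.AE_pair) simp
  then show ?thesis
  proof eventually_elim
    case (elim x)
    then have "?S x = x" by simp
    then show ?case
      using positive_definite_diagonal_pos[OF K, of i]
      by (auto simp: form_reflection_axis axis_eq_0_iff)
  qed
qed

section \<open>Symmetry of elliptical laws\<close>

text \<open>The uniqueness argument for Haar measure: the image measure \<open>\<mu>\<close> is again translation invariant, so
evaluating \<open>\<integral>\<integral> 1\<^sub>B(x) 1\<^sub>A(x + y)\<close> in both orders gives \<open>vol(B) * \<mu>(A) = vol(A) * \<mu>(B)\<close> for the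
symmetric set \<open>B\<close>; the unit ball has the same finite positive measure under both.\<close>

lemma distr_lborel_orthogonal:
  fixes Q :: "'a::euclidean_space \<Rightarrow> 'a"
  assumes Q: "orthogonal_transformation Q"
  shows "distr lborel borel Q = lborel"
proof -
  have lin: "linear Q" and norm: "norm (Q x) = norm x" for x
    using Q by (auto simp: orthogonal_transformation_linear orthogonal_transformation_norm)
  have [measurable]: "Q \<in> borel_measurable borel"
    by (rule linear_borel_measurable[OF lin])
  define \<mu> where "\<mu> = distr lborel borel Q"
  have [measurable_cong, simp]: "sets \<mu> = sets borel" and [simp]: "space \<mu> = UNIV" by (simp_all add: \<mu>_def)
  have ball: "emeasure \<mu> (ball 0 r) = emeasure lborel (ball (0 :: 'a) r)" for r
    unfolding \<mu>_def by (subst emeasure_distr) (auto intro!: arg_cong[where f="emeasure lborel"] simp: norm)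
  have finite: "emeasure lborel (ball (0 :: 'a) r) \<noteq> \<infinity>" for r
    using emeasure_lborel_ball_finite[of "0 :: 'a" r] by auto
  interpret \<mu>: sigma_finite_measure \<mu>
  proof
    show "\<exists>A :: 'a set set. countable A \<and> A \<subseteq> sets \<mu> \<and> \<Union> A = space \<mu> \<and> (\<forall>a\<in>A. emeasure \<mu> a \<noteq> \<infinity>)"
      by (intro exI[of _ "range (\<lambda>n. ball 0 (real n))"])
        (use finite in \<open>auto simp: ball intro: reals_Archimedean2\<close>)
  qed
  interpret pair_sigma_finite lborel \<mu> ..
  have shift_lborel: "(\<integral>\<^sup>+x. f x \<partial>lborel) = (\<integral>\<^sup>+x. f (c + x) \<partial>lborel)"
    if "f \<in> borel_measurable borel" for f :: "'a \<Rightarrow> ennreal" and c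
    using that by (subst lborel_distr_plus[of c, symmetric]) (simp add: nn_integral_distr)
  have shift: "(\<integral>\<^sup>+x. f x \<partial>\<mu>) = (\<integral>\<^sup>+x. f (c + x) \<partial>\<mu>)"
    if [measurable]: "f \<in> borel_measurable borel" for f :: "'a \<Rightarrow> ennreal" and c
  proof -
    obtain c' where c': "c = Q c'"
      using orthogonal_transformation_surj[OF Q] by (metis surjD)
    have "(\<integral>\<^sup>+x. f x \<partial>\<mu>) = (\<integral>\<^sup>+x. f (Q x) \<partial>lborel)"
      by (simp add: \<mu>_def nn_integral_distr)
    also have "\<dots> = (\<integral>\<^sup>+x. f (Q (c' + x)) \<partial>lborel)"
      by (rule shift_lborel) simp
    also have "\<dots> = (\<integral>\<^sup>+x. f (c + x) \<partial>\<mu>)"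
      by (simp add: \<mu>_def nn_integral_distr c' linear_add[OF lin])
    finally show ?thesis .
  qed
  let ?B = "ball 0 1 :: 'a set"
  have B: "emeasure lborel ?B \<noteq> 0" "emeasure lborel ?B \<noteq> \<infinity>"
    using emeasure_lborel_ball_finite[of "0 :: 'a" 1] content_ball_pos[of 1 "0 :: 'a"]
    by (auto simp: less_top measure_def)
  have [measurable, simp]: "(indicator ?B :: 'a \<Rightarrow> ennreal) \<in> borel_measurable borel"
    by (intro borel_measurable_indicator) simp
  show ?thesis
  proof (rule measure_eqI)
    fix A :: "'a set" assume "A \<in> sets (distr lborel borel Q)"
    then have [measurable]: "A \<in> sets borel" by simp
    have "emeasure lborel ?B * emeasure \<mu> A = (\<integral>\<^sup>+x. indicator ?B x * emeasure \<mu> A \<partial>lborel)"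
      by (subst nn_integral_multc) simp_all
    also have "\<dots> = (\<integral>\<^sup>+x. (\<integral>\<^sup>+y. indicator ?B x * indicator A (x + y) \<partial>\<mu>) \<partial>lborel)"
      by (subst nn_integral_cmult, simp, subst shift[symmetric]) simp_all
    also have "\<dots> = (\<integral>\<^sup>+y. (\<integral>\<^sup>+x. indicator ?B x * indicator A (x + y) \<partial>lborel) \<partial>\<mu>)"
      by (rule Fubini'[symmetric]) simp
    also have "\<dots> = (\<integral>\<^sup>+y. (\<integral>\<^sup>+x. indicator ?B (- y + x) * indicator A x \<partial>lborel) \<partial>\<mu>)"
    proof (rule nn_integral_cong)
      fix y
      show "(\<integral>\<^sup>+x. indicator ?B x * indicator A (x + y) \<partial>lborel)
          = (\<integral>\<^sup>+x. indicator ?B (- y + x) * indicator A x \<partial>lborel)"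
        by (subst shift_lborel[where c="- y"]) (simp_all add: add.commute)
    qed
    also have "\<dots> = (\<integral>\<^sup>+x. (\<integral>\<^sup>+y. indicator ?B (- y + x) * indicator A x \<partial>\<mu>) \<partial>lborel)"
      by (rule Fubini') simp
    also have "\<dots> = (\<integral>\<^sup>+x. (\<integral>\<^sup>+y. indicator A x * indicator ?B (- x + y) \<partial>\<mu>) \<partial>lborel)"
      by (intro nn_integral_cong) (auto simp: indicator_def norm_minus_commute)
    also have "\<dots> = (\<integral>\<^sup>+x. indicator A x * emeasure \<mu> ?B \<partial>lborel)"
      by (subst nn_integral_cmult, simp, subst shift[symmetric]) simp_all
    also have "\<dots> = emeasure lborel ?B * emeasure lborel A"
      by (subst nn_integral_multc) (simp_all add: ball mult.commute)
    finally show "emeasure (distr lborel borel Q) A = emeasure lborel A"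
      using B by (simp add: ennreal_mult_cancel_left \<mu>_def)
  qed simp
qed

lemma prob_space_uniform_sphere: "prob_space (uniform_sphere :: 'a::euclidean_space measure)"
proof -
  have B: "emeasure lborel (ball (0 :: 'a) 1) \<noteq> 0" "emeasure lborel (ball (0 :: 'a) 1) \<noteq> \<infinity>"
    using emeasure_lborel_ball_finite[of "0 :: 'a" 1] content_ball_pos[of 1 "0 :: 'a"]
    by (auto simp: less_top measure_def)
  show ?thesis
    unfolding uniform_sphere_def
    by (rule prob_space.prob_space_distr[OF prob_space_uniform_measure[OF B]]) simp
qed

text \<open>Orthogonal maps commute with the radial projection and preserve the uniform law on the ball.\<close>

lemma distr_uniform_sphere_orthogonal:
  fixes Q :: "'a::euclidean_space \<Rightarrow> 'a"
  assumes Q: "orthogonal_transformation Q"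
  shows "distr uniform_sphere borel Q = uniform_sphere"
proof (rule measure_eqI)
  have lin: "linear Q" and norm: "norm (Q x) = norm x" for x
    using Q by (auto simp: orthogonal_transformation_linear orthogonal_transformation_norm)
  have [measurable]: "Q \<in> borel_measurable borel"
    by (rule linear_borel_measurable[OF lin])
  let ?B = "ball 0 1 :: 'a set" and ?p = "\<lambda>x :: 'a. x /\<^sub>R norm x"
  fix A :: "'a set" assume "A \<in> sets (distr uniform_sphere borel Q)"
  then have [measurable]: "A \<in> sets borel" by simp
  have *: "emeasure uniform_sphere A = emeasure lborel {x \<in> ?B. ?p x \<in> A} / emeasure lborel ?B"
    if [measurable]: "A \<in> sets borel" for A :: "'a set"
    unfolding uniform_sphere_def
    by (subst emeasure_distr) (simp_all add: vimage_def Int_def)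
  have "emeasure (distr uniform_sphere borel Q) A = emeasure uniform_sphere {x. Q x \<in> A}"
    by (subst emeasure_distr) (simp_all add: uniform_sphere_def vimage_def)
  also have "\<dots> = emeasure lborel {x \<in> ?B. Q (?p x) \<in> A} / emeasure lborel ?B"
    by (subst *) simp_all
  also have "{x \<in> ?B. Q (?p x) \<in> A} = Q -` {x \<in> ?B. ?p x \<in> A}"
    by (auto simp: norm linear_scale[OF lin])
  also have "emeasure lborel (Q -` {x \<in> ?B. ?p x \<in> A}) = emeasure (distr lborel borel Q) {x \<in> ?B. ?p x \<in> A}"
    by (subst emeasure_distr) simp_all
  also have "\<dots> = emeasure lborel {x \<in> ?B. ?p x \<in> A}"
    by (simp add: distr_lborel_orthogonal[OF Q])
  also have "\<dots> / emeasure lborel ?B = emeasure uniform_sphere A"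
    by (simp add: *)
  finally show "emeasure (distr uniform_sphere borel Q) A = emeasure uniform_sphere A" .
qed (simp add: uniform_sphere_def)

text \<open>In \<open>X = \<xi> R U\<close>, a linear map \<open>S\<close> acts on \<open>U\<close> as \<open>Q = R\<^sup>-\<^sup>1 S R\<close>. Since \<open>K = R\<^sup>-\<^sup>1 R\<^sup>-\<^sup>1\<close>, it is an isometry
of \<open>K\<close> exactly when \<open>Q\<close> is orthogonal.\<close>

lemma regular_elliptical_law_invariant:
  fixes X :: "'w \<Rightarrow> real ^ 'd"
  assumes X: "regular_elliptical M X 0 \<Sigma>" and lin: "linear S"
    and isometry: "\<And>x. S x \<bullet> (matrix_inv \<Sigma> *v S x) = x \<bullet> (matrix_inv \<Sigma> *v x)"
  shows "distr M borel (\<lambda>\<omega>. S (X \<omega>)) = distr M borel X"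
proof -
  have [measurable]: "X \<in> borel_measurable M"
    using X by (simp add: regular_elliptical_def elliptical_def)
  obtain R \<nu> where R: "positive_definite R" "R ** R = \<Sigma>" and \<nu>: "prob_space \<nu>" "sets \<nu> = sets (borel :: real measure)"
    and law: "distr M borel X = distr (\<nu> \<Otimes>\<^sub>M uniform_sphere) borel (\<lambda>(r, u). 0 + r *\<^sub>R (R *v u))"
    using X unfolding regular_elliptical_def by blast
  note Rinv = positive_definite_matrix_inv[OF R(1)]
  have \<Sigma>inv: "matrix_inv \<Sigma> = matrix_inv R ** matrix_inv R"
  proof -
    have "\<Sigma> ** (matrix_inv R ** matrix_inv R) = R ** (R ** matrix_inv R) ** matrix_inv R"
      by (simp only: R(2)[symmetric] matrix_mul_assoc)
    then have "\<Sigma> ** (matrix_inv R ** matrix_inv R) = mat 1"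
      by (simp add: Rinv)
    moreover have "positive_definite \<Sigma>"
      using X by (simp add: regular_elliptical_def)
    then have "matrix_inv \<Sigma> ** \<Sigma> = mat 1"
      by (rule positive_definite_matrix_inv(2))
    ultimately show ?thesis
      using matrix_mul_assoc[of "matrix_inv \<Sigma>" \<Sigma> "matrix_inv R ** matrix_inv R"] by simp
  qed
  have form: "x \<bullet> (matrix_inv \<Sigma> *v y) = (matrix_inv R *v x) \<bullet> (matrix_inv R *v y)" for x y
    unfolding \<Sigma>inv using positive_definite_commute[OF Rinv(3), of x "matrix_inv R *v y"]
    by (simp only: matrix_vector_mul_assoc[symmetric]) (simp add: inner_commute)
  define Q where "Q u = matrix_inv R *v S (R *v u)" for u
  have linQ: "linear Q"
    unfolding Q_def
    by (rule linearI) (simp_all add: linear_add[OF lin] linear_scale[OF lin]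
        matrix_vector_right_distrib matrix_vector_mult_scaleR)
  have RQ: "R *v Q u = S (R *v u)" for u
    by (simp add: Q_def matrix_vector_mul_assoc Rinv)
  have "Q u \<bullet> Q u = u \<bullet> u" for u
    using isometry[of "R *v u"] unfolding form
    by (simp add: Q_def matrix_vector_mul_assoc Rinv)
  then have Q: "orthogonal_transformation Q"
    using linQ by (simp add: orthogonal_transformation norm_eq)
  note [measurable] = linear_borel_measurable[OF lin] linear_borel_measurable[OF linQ]
    linear_borel_measurable[OF matrix_vector_mul_linear[of R]]
  note [measurable_cong] = \<nu>(2)
  interpret U: prob_space "uniform_sphere :: (real ^ 'd) measure" by (rule prob_space_uniform_sphere)
  have [measurable_cong]: "sets uniform_sphere = sets (borel :: (real ^ 'd) measure)"
    by (simp add: uniform_sphere_def)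
  have pair: "distr (\<nu> \<Otimes>\<^sub>M uniform_sphere) (\<nu> \<Otimes>\<^sub>M borel) (\<lambda>(r, u). (r, Q u)) = \<nu> \<Otimes>\<^sub>M uniform_sphere"
    using pair_measure_distr[of "\<lambda>r. r" \<nu> \<nu> Q uniform_sphere borel] U.sigma_finite_measure_axioms
    by (simp add: distr_uniform_sphere_orthogonal[OF Q] distr_id2)
  have "distr M borel (\<lambda>\<omega>. S (X \<omega>)) = distr (distr M borel X) borel S"
    by (simp add: distr_distr comp_def)
  also have "\<dots> = distr (\<nu> \<Otimes>\<^sub>M uniform_sphere) borel (\<lambda>(r, u). r *\<^sub>R (R *v Q u))"
    unfolding law by (simp add: distr_distr comp_def case_prod_unfold linear_scale[OF lin] RQ)
  also have "\<dots> = distr (distr (\<nu> \<Otimes>\<^sub>M uniform_sphere) (\<nu> \<Otimes>\<^sub>M borel) (\<lambda>(r, u). (r, Q u))) borel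
      (\<lambda>(r, u). r *\<^sub>R (R *v u))"
    by (subst distr_distr) (simp_all add: comp_def case_prod_unfold)
  also have "\<dots> = distr M borel X"
    unfolding pair law by simp
  finally show ?thesis .
qed

text \<open>In the inner product of \<open>K\<close>, the coordinate \<open>x\<^sub>i\<close> is the product with \<open>s = \<Sigma> e\<^sub>i\<close> and \<open>(K x)\<^sub>i\<close> the product
with \<open>e\<^sub>i\<close>. The reflection \<open>S\<close> that exchanges \<open>s\<close> with the multiple \<open>c e\<^sub>i\<close> of equal length gives
\<open>(S X)\<^sub>i = c (K X)\<^sub>i\<close>, and \<open>S X\<close> has the law of \<open>X\<close>.\<close>

lemma regular_elliptical_precision_row_nonzero:
  fixes X :: "'w \<Rightarrow> real ^ 'd"
  assumes X: "regular_elliptical M X 0 \<Sigma>" and nz: "AE \<omega> in M. X \<omega> $ i \<noteq> 0"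
  shows "AE \<omega> in M. (matrix_inv \<Sigma> *v X \<omega>) $ i \<noteq> 0"
proof -
  let ?K = "matrix_inv \<Sigma>" and ?e = "axis i 1 :: real ^ 'd"
  have X_meas [measurable]: "X \<in> borel_measurable M" and \<Sigma>: "positive_definite \<Sigma>"
    using X by (simp_all add: regular_elliptical_def elliptical_def)
  note K = positive_definite_matrix_inv[OF \<Sigma>]
  have pos: "0 < ?e \<bullet> (\<Sigma> *v ?e)" "0 < ?e \<bullet> (?K *v ?e)"
    using positive_definite_pos[OF \<Sigma>, of ?e] positive_definite_pos[OF K(3), of ?e] by (simp_all add: axis_eq_0_iff)
  define c where "c = sqrt ((?e \<bullet> (\<Sigma> *v ?e)) / (?e \<bullet> (?K *v ?e)))"
  have c: "c \<noteq> 0" "c\<^sup>2 = (?e \<bullet> (\<Sigma> *v ?e)) / (?e \<bullet> (?K *v ?e))"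
    using pos by (simp_all add: c_def)
  define s where "s = \<Sigma> *v ?e"
  have Ks: "?K *v s = ?e"
    by (simp add: s_def matrix_vector_mul_assoc K)
  have "s \<bullet> (?K *v s) = (c *\<^sub>R ?e) \<bullet> (?K *v (c *\<^sub>R ?e))"
    using c pos unfolding Ks by (simp add: s_def matrix_vector_mult_scaleR power2_eq_square inner_commute field_simps)
  then have swap: "form_reflection ?K (s - c *\<^sub>R ?e) s = c *\<^sub>R ?e"
    by (rule form_reflection_exchange[OF K(3)])
  define S where "S = form_reflection ?K (s - c *\<^sub>R ?e)"
  have lin: "linear S" unfolding S_def by (rule linear_form_reflection)
  have [measurable]: "S \<in> borel_measurable borel"
    by (rule linear_borel_measurable[OF lin])
  have coord: "S x $ i = c * (?K *v x) $ i" for x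
  proof -
    have "S x $ i = S x \<bullet> (?K *v s)" by (simp add: Ks inner_axis)
    also have "\<dots> = x \<bullet> (?K *v S s)"
      unfolding S_def by (rule form_reflection_selfadjoint[OF K(3)])
    also have "\<dots> = c * (x \<bullet> (?K *v ?e))"
      using swap by (simp add: S_def matrix_vector_mult_scaleR)
    also have "x \<bullet> (?K *v ?e) = (?K *v x) $ i"
      using positive_definite_commute[OF K(3), of x ?e] by (simp add: inner_axis')
    finally show ?thesis .
  qed
  have vec: "{x :: real ^ 'd. x $ i \<noteq> 0} \<in> sets borel"
    by (intro borel_open open_Collect_neq continuous_intros)
  have "AE x in distr M borel X. x $ i \<noteq> 0"
    using nz vec by (simp add: AE_distr_iff)
  moreover have law: "distr M borel (\<lambda>\<omega>. S (X \<omega>)) = distr M borel X"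
    by (rule regular_elliptical_law_invariant[OF X lin])
      (simp add: S_def form_reflection_isometry[OF K(3)])
  ultimately have "AE x in distr M borel (\<lambda>\<omega>. S (X \<omega>)). x $ i \<noteq> 0"
    by (simp only:)
  then have "AE \<omega> in M. S (X \<omega>) $ i \<noteq> 0"
    by (rule AE_distrD[rotated]) simp
  then show ?thesis
    by (simp add: coord)
qed

section \<open>Regular conditional distributions\<close>

text \<open>The definition prescribes the joint law of \<open>Z\<close> and \<open>W\<close> on rectangles; these generate the product
\<open>\<sigma>\<close>-algebra and are closed under intersection.\<close>

lemma regular_conditional_distribution_joint:
  assumes M: "prob_space M" and Z [measurable]: "Z \<in> measurable M S" and W [measurable]: "W \<in> measurable M T"
    and rcd: "regular_conditional_distribution M S T Z W \<kappa>" and C [measurable]: "C \<in> sets (S \<Otimes>\<^sub>M T)"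
  shows "emeasure M {\<omega> \<in> space M. (Z \<omega>, W \<omega>) \<in> C} = (\<integral>\<^sup>+ z. emeasure (\<kappa> z) {w \<in> space T. (z, w) \<in> C} \<partial>distr M S Z)"
proof -
  interpret M: prob_space M by fact
  let ?D = "distr M S Z"
  interpret D: prob_space ?D by (rule M.prob_space_distr) simp
  have \<kappa> [measurable]: "\<kappa> \<in> measurable S (prob_algebra T)"
    using rcd by (simp add: regular_conditional_distribution_def)
  then have \<kappa>' [measurable]: "\<kappa> \<in> measurable S (subprob_algebra T)"
    by (rule measurable_prob_algebraD)
  have \<kappa>_space: "prob_space (\<kappa> z)" "sets (\<kappa> z) = sets T" "space (\<kappa> z) = space T" if "z \<in> space S" for z
    using measurable_space[OF \<kappa> that] sets_eq_imp_space_eq[of "\<kappa> z" T] by (auto simp: space_prob_algebra)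
  let ?g = "\<lambda>z. distr (\<kappa> z) (S \<Otimes>\<^sub>M T) (Pair z)"
  have g [measurable]: "?g \<in> measurable S (prob_algebra (S \<Otimes>\<^sub>M T))"
    by measurable
  have in_alg: "?D \<in> space (prob_algebra S)"
    by (simp add: space_prob_algebra D.prob_space_axioms)
  \<comment> \<open>The joint law obtained by drawing \<open>z\<close> from the law of \<open>Z\<close> and then
    \<open>w\<close> from \<open>\<kappa> z\<close>.\<close>
  define N where "N = bind ?D ?g"
  have N: "prob_space N" "sets N = sets (S \<Otimes>\<^sub>M T)"
    unfolding N_def using prob_space_bind'[OF in_alg g] sets_bind'[OF in_alg g] by auto
  have emeasure_N: "emeasure N C = (\<integral>\<^sup>+ z. emeasure (\<kappa> z) {w \<in> space T. (z, w) \<in> C} \<partial>?D)"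
    if "C \<in> sets (S \<Otimes>\<^sub>M T)" for C
    unfolding N_def emeasure_bind_prob_algebra[OF in_alg g that]
  proof (rule nn_integral_cong)
    fix z assume "z \<in> space ?D"
    then have z: "z \<in> space S" by simp
    have "Pair z \<in> measurable (\<kappa> z) (S \<Otimes>\<^sub>M T)"
      unfolding measurable_cong_sets[OF \<kappa>_space(2)[OF z] refl] using z by simp
    then show "emeasure (?g z) C = emeasure (\<kappa> z) {w \<in> space T. (z, w) \<in> C}"
      using that \<kappa>_space[OF z] by (simp add: emeasure_distr vimage_def Int_def conj_commute)
  qed
  interpret joint: prob_space "distr M (S \<Otimes>\<^sub>M T) (\<lambda>\<omega>. (Z \<omega>, W \<omega>))"
    by (rule M.prob_space_distr) simp
  have "distr M (S \<Otimes>\<^sub>M T) (\<lambda>\<omega>. (Z \<omega>, W \<omega>)) = N"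
  proof (rule measure_eqI_generator_eq[OF Int_stable_pair_measure_generator[of S T], where A = "\<lambda>_. space S \<times> space T"])
    show "{a \<times> b |a b. a \<in> sets S \<and> b \<in> sets T} \<subseteq> Pow (space S \<times> space T)"
      using sets.space_closed[of S] sets.space_closed[of T] by auto
    fix X assume "X \<in> {a \<times> b |a b. a \<in> sets S \<and> b \<in> sets T}"
    then obtain A B where X: "X = A \<times> B" and AB [measurable]: "A \<in> sets S" "B \<in> sets T" by auto
    have "emeasure (distr M (S \<Otimes>\<^sub>M T) (\<lambda>\<omega>. (Z \<omega>, W \<omega>))) X = emeasure M {\<omega> \<in> space M. Z \<omega> \<in> A \<and> W \<omega> \<in> B}"
      unfolding X by (subst emeasure_distr) (auto intro!: arg_cong[where f="emeasure M"])
    also have "\<dots> = (\<integral>\<^sup>+ z \<in> A. emeasure (\<kappa> z) B \<partial>?D)"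
      using rcd AB by (simp add: regular_conditional_distribution_def)
    also have "\<dots> = (\<integral>\<^sup>+ z. emeasure (\<kappa> z) {w \<in> space T. (z, w) \<in> X} \<partial>?D)"
      unfolding X using sets.sets_into_space[OF AB(2)]
      by (intro nn_integral_cong)
        (auto simp: indicator_def Int_absorb1 intro!: arg_cong2[where f=emeasure])
    also have "\<dots> = emeasure N X"
      unfolding X by (rule emeasure_N[symmetric]) simp
    finally show "emeasure (distr M (S \<Otimes>\<^sub>M T) (\<lambda>\<omega>. (Z \<omega>, W \<omega>))) X = emeasure N X" .
  qed (auto simp: N sets_pair_measure joint.emeasure_eq_measure)
  then have "emeasure (distr M (S \<Otimes>\<^sub>M T) (\<lambda>\<omega>. (Z \<omega>, W \<omega>))) C = emeasure N C" by simp
  then show ?thesis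
    using emeasure_N[OF C] by (simp add: emeasure_distr vimage_def Int_def conj_commute)
qed

lemma regular_conditional_distribution_image:
  assumes M: "prob_space M" and Z [measurable]: "Z \<in> measurable M S" and W [measurable]: "W \<in> measurable M T"
    and rcd: "regular_conditional_distribution M S T Z W \<kappa>"
    and h [measurable]: "(\<lambda>(z, w). h z w) \<in> measurable (S \<Otimes>\<^sub>M T) R"
  shows "regular_conditional_distribution M S R Z (\<lambda>\<omega>. h (Z \<omega>) (W \<omega>)) (\<lambda>z. distr (\<kappa> z) R (h z))"
  unfolding regular_conditional_distribution_def
proof (intro conjI ballI)
  have \<kappa> [measurable]: "\<kappa> \<in> measurable S (prob_algebra T)"
    using rcd by (simp add: regular_conditional_distribution_def)
  show "(\<lambda>z. distr (\<kappa> z) R (h z)) \<in> measurable S (prob_algebra R)"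
    by measurable
  fix A B assume [measurable]: "A \<in> sets S" "B \<in> sets R"
  let ?C = "{q \<in> space (S \<Otimes>\<^sub>M T). fst q \<in> A \<and> (case q of (z, w) \<Rightarrow> h z w) \<in> B}"
  have "emeasure M {\<omega> \<in> space M. Z \<omega> \<in> A \<and> h (Z \<omega>) (W \<omega>) \<in> B} = emeasure M {\<omega> \<in> space M. (Z \<omega>, W \<omega>) \<in> ?C}"
    using measurable_space[OF Z] measurable_space[OF W]
    by (intro arg_cong[where f="emeasure M"]) (auto simp: space_pair_measure)
  also have "\<dots> = (\<integral>\<^sup>+ z. emeasure (\<kappa> z) {w \<in> space T. (z, w) \<in> ?C} \<partial>distr M S Z)"
    by (rule regular_conditional_distribution_joint[OF M Z W rcd]) simp
  also have "\<dots> = (\<integral>\<^sup>+ z \<in> A. emeasure (distr (\<kappa> z) R (h z)) B \<partial>distr M S Z)"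
  proof (rule nn_integral_cong)
    fix z assume "z \<in> space (distr M S Z)"
    then have z: "z \<in> space S" by simp
    have \<kappa>z: "sets (\<kappa> z) = sets T" "space (\<kappa> z) = space T"
      using measurable_space[OF \<kappa> z] sets_eq_imp_space_eq[of "\<kappa> z" T] by (auto simp: space_prob_algebra)
    have "h z \<in> measurable (\<kappa> z) R"
      unfolding measurable_cong_sets[OF \<kappa>z(1) refl] using measurable_Pair2[OF h z] by simp
    then have "emeasure (distr (\<kappa> z) R (h z)) B = emeasure (\<kappa> z) {w \<in> space T. h z w \<in> B}"
      by (subst emeasure_distr) (auto simp: \<kappa>z intro!: arg_cong[where f="emeasure (\<kappa> z)"])
    then show "emeasure (\<kappa> z) {w \<in> space T. (z, w) \<in> ?C} =
        emeasure (distr (\<kappa> z) R (h z)) B * indicator A z"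
      using z by (auto simp: space_pair_measure indicator_def)
  qed
  finally show "emeasure M {\<omega> \<in> space M. Z \<omega> \<in> A \<and> h (Z \<omega>) (W \<omega>) \<in> B} =
      (\<integral>\<^sup>+ z \<in> A. emeasure (distr (\<kappa> z) R (h z)) B \<partial>distr M S Z)" .
qed

text \<open>Finite intersections of the sets of a countable basis.\<close>

lemma countable_Int_stable_generator_borel:
  obtains G :: "'a::second_countable_topology set set"
  where "countable G" "Int_stable G" "UNIV \<in> G" "sets (borel :: 'a measure) = sigma_sets UNIV G"
proof -
  obtain B :: "'a set set" where B: "countable B" "topological_basis B"
    using ex_countable_basis by auto
  let ?G = "{\<Inter>F | F. finite F \<and> F \<subseteq> B}"
  show thesis
  proof (rule that[of ?G])
    have "?G = Inter ` {F. finite F \<and> F \<subseteq> B}" by auto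
    then show "countable ?G"
      using countable_Collect_finite_subset[OF B(1)] by simp
    show "Int_stable ?G"
    proof (rule Int_stableI)
      fix a b assume "a \<in> ?G" "b \<in> ?G"
      then obtain F F' where F: "a = \<Inter>F" "b = \<Inter>F'" "finite F" "finite F'" "F \<subseteq> B" "F' \<subseteq> B" by auto
      show "a \<inter> b \<in> ?G"
        using F by (intro CollectI exI[of _ "F \<union> F'"]) auto
    qed
    show "UNIV \<in> ?G" by (rule CollectI) (rule exI[of _ "{}"], simp)
    have "open (\<Inter>F)" if "finite F" "F \<subseteq> B" for F
      using that topological_basis_open[OF B(2)] by (intro open_Inter) auto
    then have "?G \<subseteq> sets borel"
      by (auto intro: borel_open)
    moreover have "B \<subseteq> ?G"
      by (auto intro!: exI[of _ "{_}"])
    ultimately show "sets (borel :: 'a measure) = sigma_sets UNIV ?G"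
      using sigma_sets_mono'[of B ?G UNIV] sets.sigma_sets_subset[of ?G borel]
      by (auto simp: borel_eq_countable_basis[OF B])
  qed
qed

text \<open>For a single Borel set the two kernels agree off a null set that depends on the set. A countable
intersection-stable generator makes one null set serve for all sets at once.\<close>

lemma regular_conditional_distribution_unique:
  fixes W W' :: "'w \<Rightarrow> 'b::second_countable_topology"
  assumes M: "prob_space M" and Z [measurable]: "Z \<in> measurable M S"
    and \<kappa>: "regular_conditional_distribution M S borel Z W \<kappa>"
    and \<kappa>': "regular_conditional_distribution M S borel Z W' \<kappa>'"
    and same: "\<And>A B. A \<in> sets S \<Longrightarrow> B \<in> sets borel \<Longrightarrow>
      emeasure M {\<omega> \<in> space M. Z \<omega> \<in> A \<and> W \<omega> \<in> B} = emeasure M {\<omega> \<in> space M. Z \<omega> \<in> A \<and> W' \<omega> \<in> B}"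
  shows "AE z in distr M S Z. \<kappa> z = \<kappa>' z"
proof -
  interpret M: prob_space M by fact
  let ?D = "distr M S Z"
  interpret D: prob_space ?D by (rule M.prob_space_distr) simp
  have [measurable]: "\<kappa> \<in> measurable S (prob_algebra borel)" "\<kappa>' \<in> measurable S (prob_algebra borel)"
    using \<kappa> \<kappa>' by (simp_all add: regular_conditional_distribution_def)
  then have [measurable]: "\<kappa> \<in> measurable S (subprob_algebra borel)" "\<kappa>' \<in> measurable S (subprob_algebra borel)"
    by (simp_all add: measurable_prob_algebraD)
  obtain G :: "'b set set" where G: "countable G" "Int_stable G" "UNIV \<in> G" "sets (borel :: 'b measure) = sigma_sets UNIV G"
    by (rule countable_Int_stable_generator_borel)
  have "AE z in ?D. emeasure (\<kappa> z) B = emeasure (\<kappa>' z) B" if "B \<in> G" for B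
  proof -
    have B [measurable]: "B \<in> sets borel" using G that by auto
    have "density ?D (\<lambda>z. emeasure (\<kappa> z) B) = density ?D (\<lambda>z. emeasure (\<kappa>' z) B)"
    proof (rule measure_eqI)
      fix A assume "A \<in> sets (density ?D (\<lambda>z. emeasure (\<kappa> z) B))"
      then have "A \<in> sets S" by simp
      then show "emeasure (density ?D (\<lambda>z. emeasure (\<kappa> z) B)) A = emeasure (density ?D (\<lambda>z. emeasure (\<kappa>' z) B)) A"
        using same[of A B] B \<kappa> \<kappa>' by (simp add: emeasure_density regular_conditional_distribution_def)
    qed simp
    then show ?thesis
      by (subst (asm) D.density_unique_iff) simp_all
  qed
  then have "AE z in ?D. \<forall>B\<in>G. emeasure (\<kappa> z) B = emeasure (\<kappa>' z) B"
    using G(1) by (intro AE_ball_countable') auto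
  then show ?thesis
  proof (rule AE_mp, intro AE_I2 impI)
    fix z assume z: "z \<in> space ?D" and eq: "\<forall>B\<in>G. emeasure (\<kappa> z) B = emeasure (\<kappa>' z) B"
    have "\<kappa> z \<in> space (prob_algebra borel)" "\<kappa>' z \<in> space (prob_algebra borel)"
      using z by (auto intro!: measurable_space[where M=S])
    then have *: "sets (\<kappa> z) = sets borel" "prob_space (\<kappa> z)" "sets (\<kappa>' z) = sets borel" 
      by (auto simp: space_prob_algebra)
    interpret \<kappa>z: prob_space "\<kappa> z" by fact
    show "\<kappa> z = \<kappa>' z"
      by (rule measure_eqI_generator_eq[OF G(2), where A="\<lambda>_. UNIV" and \<Omega>=UNIV])
        (use G eq * in \<open>auto\<close>)
  qed
qed

text \<open>An event of probability \<open>0\<close> has conditional probability of mean \<open>0\<close>.\<close>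

lemma regular_conditional_distribution_AE:
  assumes Z: "Z \<in> measurable M S"
    and rcd: "regular_conditional_distribution M S T Z W \<kappa>"
    and B: "{w \<in> space T. P w} \<in> sets T" and ae: "AE \<omega> in M. P (W \<omega>)" and W: "W \<in> measurable M T"
  shows "AE z in distr M S Z. AE w in \<kappa> z. P w"
proof -
  have \<kappa>: "\<kappa> \<in> measurable S (prob_algebra T)"
    using rcd by (simp add: regular_conditional_distribution_def)
  note [measurable] = Z W measurable_prob_algebraD[OF \<kappa>]
  have rect: "emeasure M {\<omega> \<in> space M. Z \<omega> \<in> A \<and> W \<omega> \<in> B} = (\<integral>\<^sup>+ z \<in> A. emeasure (\<kappa> z) B \<partial>distr M S Z)"
    if "A \<in> sets S" "B \<in> sets T" for A B
    using rcd that by (simp add: regular_conditional_distribution_def)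
  let ?B = "{w \<in> space T. \<not> P w}"
  have [measurable]: "?B \<in> sets T"
    using sets.compl_sets[OF B] by (simp add: set_diff_eq Collect_conj_eq[symmetric]) 
      (metis (no_types, lifting) Collect_cong)
  have "(\<integral>\<^sup>+ z. emeasure (\<kappa> z) ?B \<partial>distr M S Z) = (\<integral>\<^sup>+ z \<in> space S. emeasure (\<kappa> z) ?B \<partial>distr M S Z)"
    by (intro nn_integral_cong) simp
  also have "\<dots> = emeasure M {\<omega> \<in> space M. Z \<omega> \<in> space S \<and> W \<omega> \<in> ?B}"
    by (rule rect[symmetric]) simp_all
  also have "\<dots> = 0"
  proof -
    have "{\<omega> \<in> space M. Z \<omega> \<in> space S \<and> W \<omega> \<in> ?B} = {\<omega> \<in> space M. \<not> P (W \<omega>)}"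
      using measurable_space[OF Z] measurable_space[OF W] by auto
    moreover have "{\<omega> \<in> space M. \<not> P (W \<omega>)} = W -` ?B \<inter> space M"
      using measurable_space[OF W] by auto
    then have "{\<omega> \<in> space M. \<not> P (W \<omega>)} \<in> sets M" by simp
    from AE_iff_measurable[OF this refl] have "emeasure M {\<omega> \<in> space M. \<not> P (W \<omega>)} = 0"
      using ae by simp
    ultimately show ?thesis by simp
  qed
  finally have "AE z in distr M S Z. emeasure (\<kappa> z) ?B = 0"
    by (subst (asm) nn_integral_0_iff_AE) simp_all
  moreover have "AE z in distr M S Z. emeasure (\<kappa> z) ?B = 0 \<longrightarrow> (AE w in \<kappa> z. P w)"
  proof (rule AE_I2, rule impI)
    fix z assume z: "z \<in> space (distr M S Z)" and null: "emeasure (\<kappa> z) ?B = 0"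
    then have "sets (\<kappa> z) = sets T" "space (\<kappa> z) = space T"
      using measurable_space[OF \<kappa>, of z] sets_eq_imp_space_eq[of "\<kappa> z" T] by (auto simp: space_prob_algebra)
    then show "AE w in \<kappa> z. P w"
      using null by (intro AE_I[of _ _ ?B]) auto
  qed
  ultimately show ?thesis by (rule AE_mp)
qed

section \<open>The conditional law of a transelliptical vector\<close>

lemma drop_coords_measurable:
  "drop_coords i j \<in> measurable borel (PiM (- {i, j}) (\<lambda>_. borel))"
  unfolding drop_coords_def[abs_def] by measurable

text \<open>The vector \<open>X\<close> as a function of the conditioning coordinates of \<open>Y\<close> and the pair \<open>(Y\<^sub>i, Y\<^sub>j)\<close>. Its image of
the conditional law of the pair is the conditional law of the whole vector \<open>X\<close>; working with
it keeps the reflections linear, whereas on the pair alone they would be affine with a centre that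
depends on the conditioning value.\<close>

definition assemble :: "('d \<Rightarrow> real \<Rightarrow> real) \<Rightarrow> 'd \<Rightarrow> 'd \<Rightarrow> ('d \<Rightarrow> real) \<Rightarrow> real \<times> real \<Rightarrow> real ^ 'd" where
  "assemble f i j z w = (\<chi> k. f k (if k = i then fst w else if k = j then snd w else z k))"

lemma assemble_nth:
  "assemble f i j z w $ i = f i (fst w)"
  "i \<noteq> j \<Longrightarrow> assemble f i j z w $ j = f j (snd w)"
  "k \<noteq> i \<Longrightarrow> k \<noteq> j \<Longrightarrow> assemble f i j z w $ k = f k (z k)"
  by (simp_all add: assemble_def)

lemma assemble_drop_coords:
  "i \<noteq> j \<Longrightarrow> assemble f i j (drop_coords i j y) (y $ i, y $ j) = (\<chi> k. f k (y $ k))"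
  by (simp add: assemble_def drop_coords_def vec_eq_iff)

lemma assemble_measurable:
  assumes f: "\<And>k. strict_mono (f k)"
  shows "(\<lambda>(z, w). assemble f i j z w) \<in> measurable (PiM (- {i, j}) (\<lambda>_. borel) \<Otimes>\<^sub>M borel) borel"
proof -
  have [measurable]: "f k \<in> borel_measurable borel" for k
    using f by (rule strict_mono_borel_measurable)
  show ?thesis
    unfolding assemble_def[abs_def] case_prod_unfold
  proof (rule borel_measurable_vec_lambda)
    fix k
    show "(\<lambda>q. f k (if k = i then fst (snd q) else if k = j then snd (snd q) else fst q k))
      \<in> borel_measurable (PiM (- {i, j}) (\<lambda>_. borel) \<Otimes>\<^sub>M borel)"
      by (cases "k = i"; cases "k = j") simp_all
  qed
qed

text \<open>If \<open>S\<close> preserves the conditioning variable \<open>Z = G X\<close>, then \<open>(Z, S X)\<close> has the law of \<open>(Z, X)\<close>, so the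
images of the kernel under \<open>S\<close> again form a conditional law of \<open>X\<close> given \<open>Z\<close>, and uniqueness applies.\<close>

lemma conditional_law_isometry_invariant:
  fixes X :: "'w \<Rightarrow> real ^ 'd"
  assumes M: "prob_space M" and X: "regular_elliptical M X 0 \<Sigma>"
    and Z: "Z \<in> measurable M N" and G [measurable]: "G \<in> measurable borel N" and ZG: "\<And>\<omega>. \<omega> \<in> space M \<Longrightarrow> Z \<omega> = G (X \<omega>)"
    and \<kappa>: "regular_conditional_distribution M N borel Z X \<kappa>"
    and lin: "linear S" and isometry: "\<And>x. S x \<bullet> (matrix_inv \<Sigma> *v S x) = x \<bullet> (matrix_inv \<Sigma> *v x)"
    and GS: "\<And>x. G (S x) = G x"
  shows "AE z in distr M N Z. distr (\<kappa> z) borel S = \<kappa> z"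
proof -
  have X_meas [measurable]: "X \<in> borel_measurable M"
    using X by (simp add: regular_elliptical_def elliptical_def)
  have S [measurable]: "S \<in> borel_measurable borel" by (rule linear_borel_measurable[OF lin])
  have "regular_conditional_distribution M N borel Z (\<lambda>\<omega>. S (X \<omega>)) (\<lambda>z. distr (\<kappa> z) borel S)"
    by (rule regular_conditional_distribution_image[OF M Z X_meas \<kappa>]) measurable
  then show ?thesis
  proof (rule regular_conditional_distribution_unique[OF M Z _ \<kappa>])
    fix A and B :: "(real ^ 'd) set" assume [measurable]: "A \<in> sets N" "B \<in> sets borel"
    let ?C = "{x. G x \<in> A \<and> x \<in> B}"
    have "emeasure M {\<omega> \<in> space M. Z \<omega> \<in> A \<and> S (X \<omega>) \<in> B} = emeasure (distr M borel (\<lambda>\<omega>. S (X \<omega>))) ?C"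
      by (subst emeasure_distr) (auto simp: ZG GS intro!: arg_cong[where f="emeasure M"])
    also have "\<dots> = emeasure (distr M borel X) ?C"
      by (simp add: regular_elliptical_law_invariant[OF X lin isometry])
    also have "\<dots> = emeasure M {\<omega> \<in> space M. Z \<omega> \<in> A \<and> X \<omega> \<in> B}"
      by (subst emeasure_distr) (auto simp: ZG intro!: arg_cong[where f="emeasure M"])
    finally show "emeasure M {\<omega> \<in> space M. Z \<omega> \<in> A \<and> S (X \<omega>) \<in> B} = emeasure M {\<omega> \<in> space M. Z \<omega> \<in> A \<and> X \<omega> \<in> B}" .
  qed
qed

text \<open>The quantifier over \<open>g\<close> and \<open>h\<close> can stand inside the almost sure statement because the sign differences
do not depend on them. Both implications hold at almost every value of the conditioning
variable; in particular the conditional tau is almost surely nonzero when \<open>K\<^sub>i\<^sub>j \<noteq> 0\<close>.\<close>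

lemma cond_kendall_tau_eq_0_iff_AE:
  fixes M :: "'w measure"
    and Y :: "'w \<Rightarrow> real ^ 'd"
  assumes M: "prob_space M" and ij: "i \<noteq> j"
    and trans: "transelliptical M Y 0 \<Sigma>"
    and cont: "continuous_random_vector M Y"
    and rcd: "regular_conditional_distribution M (PiM (- {i, j}) (\<lambda>_. borel)) borel
           (\<lambda>\<omega>. drop_coords i j (Y \<omega>)) (\<lambda>\<omega>. (Y \<omega> $ i, Y \<omega> $ j)) \<kappa>"
  shows "AE \<omega> in M. \<forall>g h. strict_mono g \<and> strict_mono h \<longrightarrow>
    (cond_kendall_tau \<kappa> g h (drop_coords i j (Y \<omega>)) = 0 \<longleftrightarrow> matrix_inv \<Sigma> $ i $ j = 0)"
proof -
  interpret M: prob_space M by fact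
  let ?N = "PiM (- {i, j}) (\<lambda>_. borel :: real measure)" and ?Z = "\<lambda>\<omega>. drop_coords i j (Y \<omega>)"
  let ?W = "\<lambda>\<omega>. (Y \<omega> $ i, Y \<omega> $ j)"
  let ?K = "matrix_inv \<Sigma>"
  obtain f where f: "\<And>k. strict_mono (f k)" and ell: "regular_elliptical M (\<lambda>\<omega>. \<chi> k. f k (Y \<omega> $ k)) 0 \<Sigma>"
    using trans by (auto simp: transelliptical_def)
  define X where "X \<omega> = (\<chi> k. f k (Y \<omega> $ k))" for \<omega>
  have X: "regular_elliptical M X 0 \<Sigma>" using ell by (simp add: X_def[abs_def])
  have [measurable]: "Y \<in> borel_measurable M" using trans by (simp add: transelliptical_def)
  have X_meas [measurable]: "X \<in> borel_measurable M"
    using X by (simp add: regular_elliptical_def elliptical_def)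
  have K: "positive_definite ?K"
    using X by (intro positive_definite_matrix_inv(3)) (simp add: regular_elliptical_def)
  note [measurable] = drop_coords_measurable strict_mono_borel_measurable[OF f]
  have Z: "?Z \<in> measurable M ?N" and W: "?W \<in> measurable M borel"
    by measurable
  have \<kappa>: "\<kappa> \<in> measurable ?N (prob_algebra borel)"
    using rcd by (simp add: regular_conditional_distribution_def)

  \<comment> \<open>Left inverses of the \<open>f k\<close> recover the conditioning coordinates of
    \<open>Y\<close> from \<open>X\<close>, so that isometries acting on \<open>X\<close> can
    be compared given \<open>Z\<close>.\<close>
  have "\<exists>g. g \<in> borel_measurable borel \<and> (\<forall>x. g (f k x) = x)" for k
    by (rule strict_mono_measurable_left_inverse[OF f[of k]]) blast
  then have "\<exists>g. \<forall>k. g k \<in> borel_measurable borel \<and> (\<forall>x. g k (f k x) = x)"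
    by (intro choice allI)
  then obtain g where g [measurable]: "\<And>k. g k \<in> borel_measurable borel" and gf: "\<And>k x. g k (f k x) = x"
    by auto
  define G where "G x = restrict (\<lambda>k. g k (x $ k)) (- {i, j})" for x :: "real ^ 'd"
  have G: "G \<in> measurable borel ?N"
    unfolding G_def[abs_def] by measurable
  have ZG: "?Z \<omega> = G (X \<omega>)" for \<omega>
    by (simp add: G_def X_def drop_coords_def gf)

  define \<kappa>X where "\<kappa>X z = distr (\<kappa> z) borel (assemble f i j z)" for z
  have rcdX: "regular_conditional_distribution M ?N borel ?Z X \<kappa>X"
    using regular_conditional_distribution_image[OF M Z W rcd assemble_measurable[OF f]]
    by (simp add: assemble_drop_coords[OF ij] X_def[abs_def] \<kappa>X_def[abs_def])

  define L where "L = {v :: real ^ 'd. \<forall>k. k \<noteq> i \<and> k \<noteq> j \<longrightarrow> v $ k = 0}"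
  obtain V where V: "countable V" "V \<subseteq> L" "L \<subseteq> closure V"
    by (rule separable)
  have "AE z in distr M ?N ?Z. distr (\<kappa>X z) borel (form_reflection ?K v) = \<kappa>X z" if "v \<in> L" for v
  proof (rule conditional_law_isometry_invariant[OF M X Z G ZG rcdX linear_form_reflection form_reflection_isometry[OF K]])
    fix x
    show "G (form_reflection ?K v x) = G x"
      using that by (auto simp: G_def L_def form_reflection_def restrict_def)
  qed
  moreover have "axis i 1 \<in> L" by (auto simp: L_def axis_def)
  ultimately have inv: "AE z in distr M ?N ?Z. \<forall>v\<in>insert (axis i 1) V.
      distr (\<kappa>X z) borel (form_reflection ?K v) = \<kappa>X z"
    using V by (intro AE_ball_countable') auto

  \<comment> \<open>As \<open>f i\<close> is injective, \<open>X\<^sub>i = 0\<close> forces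
    \<open>Y\<^sub>i\<close> to be one particular value, if it is possible at all.\<close>
  have "AE \<omega> in M. X \<omega> $ i \<noteq> 0"
  proof (cases "\<exists>y. f i y = 0")
    case True
    then obtain y where y: "f i y = 0" by blast
    have "f i (Y \<omega> $ i) = 0 \<Longrightarrow> Y \<omega> $ i = y" for \<omega>
      using y gf by metis
    moreover have "measure M {\<omega> \<in> space M. Y \<omega> $ i = y} = 0"
      using cont by (simp add: continuous_random_vector_def)
    then have "AE \<omega> in M. Y \<omega> $ i \<noteq> y"
      by (intro AE_I[of _ _ "{\<omega> \<in> space M. Y \<omega> $ i = y}"]) (auto simp: M.emeasure_eq_measure)
    ultimately show ?thesis by (auto simp: X_def elim!: eventually_mono)
  qed (auto simp: X_def)
  then have row0: "AE \<omega> in M. (?K *v X \<omega>) $ i \<noteq> 0"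
    by (rule regular_elliptical_precision_row_nonzero[OF X])
  have row: "AE z in distr M ?N ?Z. AE x in \<kappa>X z. (?K *v x) $ i \<noteq> 0"
  proof (rule regular_conditional_distribution_AE[OF Z rcdX _ row0 X_meas])
    have "linear (\<lambda>x. ?K *v x)" by (rule matrix_vector_mul_linear)
    note [measurable] = linear_borel_measurable[OF this]
    show "{x \<in> space borel. (?K *v x) $ i \<noteq> 0} \<in> sets borel" by measurable
  qed

  have "AE z in distr M ?N ?Z. \<forall>g h. strict_mono g \<and> strict_mono h \<longrightarrow>
    (cond_kendall_tau \<kappa> g h z = 0 \<longleftrightarrow> ?K $ i $ j = 0)"
    using inv row
  proof (rule AE_mp[OF AE_conjI], intro AE_I2 impI)
    fix z assume "z \<in> space (distr M ?N ?Z)"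
    then have z: "z \<in> space ?N" by simp
    assume *: "(\<forall>v\<in>insert (axis i 1) V. distr (\<kappa>X z) borel (form_reflection ?K v) = \<kappa>X z) \<and>
      (AE x in \<kappa>X z. (?K *v x) $ i \<noteq> 0)"
    have P: "prob_space (\<kappa> z)" "sets (\<kappa> z) = sets borel"
      using measurable_space[OF \<kappa> z] by (auto simp: space_prob_algebra)
    note [measurable_cong] = P(2)
    have [measurable]: "assemble f i j z \<in> borel_measurable (\<kappa> z)"
      unfolding measurable_cong_sets[OF P(2) refl]
      using measurable_Pair2[OF assemble_measurable[OF f] z] by simp
    have PX: "prob_space (\<kappa>X z)" "sets (\<kappa>X z) = sets borel"
      unfolding \<kappa>X_def by (auto intro: prob_space.prob_space_distr[OF P(1)])
    interpret PX: prob_space "\<kappa>X z" by fact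
    have plane: "AE x in \<kappa>X z. \<forall>k. k \<noteq> i \<and> k \<noteq> j \<longrightarrow> x $ k = f k (z k)"
      unfolding \<kappa>X_def by (subst AE_distr_iff) (auto simp: assemble_nth)
    have inv: "distr (\<kappa>X z) (\<kappa>X z) (form_reflection ?K v) = \<kappa>X z" if "v \<in> insert (axis i 1) V" for v
    proof -
      have "distr (\<kappa>X z) (\<kappa>X z) (form_reflection ?K v) = distr (\<kappa>X z) borel (form_reflection ?K v)"
        by (intro distr_cong) (simp_all add: PX(2))
      also have "\<dots> = \<kappa>X z"
        using * that by blast
      finally show ?thesis .
    qed
    have conc: "concordance (\<kappa>X z) (\<lambda>x. x $ i) (\<lambda>x. x $ j) = concordance (\<kappa> z) fst snd"
      unfolding \<kappa>X_def
      by (subst concordance_distr[OF P(1)]) (simp_all add: assemble_nth ij concordance_strict_mono[OF f f])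
    have "concordance (\<kappa>X z) (\<lambda>x. x $ i) (\<lambda>x. x $ j) = 0 \<longleftrightarrow> ?K $ i $ j = 0"
    proof
      assume zero: "concordance (\<kappa>X z) (\<lambda>x. x $ i) (\<lambda>x. x $ j) = 0"
      show "?K $ i $ j = 0"
      proof (rule ccontr)
        assume "?K $ i $ j \<noteq> 0"
        then have "AE x in \<kappa>X z. (?K *v x) $ i = 0"
          using precision_row_eq_0_if_concordance_eq_0[OF PX K ij plane V(1) _ inv _ zero] V(3) by (simp add: L_def)
        with conjunct2[OF *] have "AE x in \<kappa>X z. False" by eventually_elim simp
        then show False by simp
      qed
    next
      assume "?K $ i $ j = 0"
      then show "concordance (\<kappa>X z) (\<lambda>x. x $ i) (\<lambda>x. x $ j) = 0"
        using concordance_eq_0_if_uncoupled[OF PX K ij plane inv] by simp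
    qed
    then show "\<forall>g h. strict_mono g \<and> strict_mono h \<longrightarrow> (cond_kendall_tau \<kappa> g h z = 0 \<longleftrightarrow> ?K $ i $ j = 0)"
      using cond_kendall_tau_eq_0_iff_concordance[of \<kappa> z, OF P] conc by simp
  qed
  then show ?thesis
    by (rule AE_distrD[OF Z])
qed

theorem proposition3p9:
  fixes M :: "'w measure"
    and Y :: "'w \<Rightarrow> real ^ 'd"
    and \<Sigma> K :: "real ^ 'd ^ 'd"
    and i j :: 'd
    and \<kappa> :: "('d \<Rightarrow> real) \<Rightarrow> (real \<times> real) measure"
  assumes "prob_space M"
    and "CARD('d) \<ge> 2"
    and "i \<noteq> j"
    and "K = matrix_inv \<Sigma>"
    and "transelliptical M Y 0 \<Sigma>"
    and "continuous_random_vector M Y"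
    and "regular_conditional_distribution M (PiM (- {i, j}) (\<lambda>_. borel)) borel
           (\<lambda>\<omega>. drop_coords i j (Y \<omega>)) (\<lambda>\<omega>. (Y \<omega> $ i, Y \<omega> $ j)) \<kappa>"
  shows "(K $ i $ j = 0 \<longleftrightarrow>
           (\<forall>g h. strict_mono g \<and> strict_mono h \<longrightarrow>
              (AE \<omega> in M. cond_kendall_tau \<kappa> g h (drop_coords i j (Y \<omega>)) = 0))) \<and>
         (K $ i $ j = 0 \<longleftrightarrow>
           (AE \<omega> in M. cond_kendall_tau \<kappa> id id (drop_coords i j (Y \<omega>)) = 0))"
proof -
  interpret M: prob_space M by fact
  let ?tau = "\<lambda>g h \<omega>. cond_kendall_tau \<kappa> g h (drop_coords i j (Y \<omega>))"
  note key = cond_kendall_tau_eq_0_iff_AE[OF assms(1,3,5,6,7)]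
  have iff: "(AE \<omega> in M. ?tau g h \<omega> = 0) \<longleftrightarrow> K $ i $ j = 0" if gh: "strict_mono g" "strict_mono h" for g h
  proof
    assume "AE \<omega> in M. ?tau g h \<omega> = 0"
    with key have "AE \<omega> in M. K $ i $ j = 0"
      by eventually_elim (use gh assms(4) in blast)
    then show "K $ i $ j = 0" by simp
  next
    assume "K $ i $ j = 0"
    with key assms(4) gh show "AE \<omega> in M. ?tau g h \<omega> = 0"
      by (auto elim!: eventually_mono)
  qed
  moreover have id: "strict_mono (id :: real \<Rightarrow> real)"
    by (simp add: strict_mono_def)
  ultimately show ?thesis
    by blast
qed

end
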